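(* Let $\mathcal{X},\mathcal{Y}$ be Hilbert modules over a pro-$C^*$-algebra $\mathcal{A}$ and let $T,L\in Hom^*_{\mathcal{A}}(\mathcal{X},\mathcal{Y})$. Then the following are equivalent: (i) $TT^*\le LL^*$; (ii) $\bar p_{\mathcal{X}}(T^*\xi)\le \bar p_{\mathcal{X}}(L^*\xi)$ for all $\xi\in\mathcal{Y}$ and all $p\in S(\mathcal{A})$.
   Context: A pro-$C^*$-algebra $\mathcal{A}$ is a complete Hausdorff topological $*$-algebra whose topology is given by its family $S(\mathcal{A})$ of continuous $C^*$-seminorms. A Hilbert $\mathcal{A}$-module is a left $\mathcal{A}$-module with an $\mathcal{A}$-valued inner product, complete for the seminorms $\bar p_{\mathcal{X}}(\xi)=\sqrt{p(\langle\xi,\xi\rangle)}$, $p\in S(\mathcal{A})$. $Hom^*_{\mathcal{A}}(\mathcal{X},\mathcal{Y})$ denotes adjointable bounded $\mathcal{A}$-module maps. For self-adjoint $S,R\in Hom^*_{\mathcal{A}}(\mathcal{Y})$, $S\le R$ means $\langle (R-S)\xi,\xi\rangle\ge 0$ in $\mathcal{A}$ for all $\xi\in\mathcal{Y}$. *)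

theory Defs
  imports Complex_Main
begin

text \<open>A complex *-algebra structure on a (possibly non-unital) ring type 'a,
  together with a family of seminorms defining its topology.\<close>

record 'a pro_alg =
  sm :: "complex \<Rightarrow> 'a \<Rightarrow> 'a"
  st :: "'a \<Rightarrow> 'a"
  sn :: "('a \<Rightarrow> real) set"           (* S(A): continuous C*-seminorms *)

definition complex_vs :: "(complex \<Rightarrow> ('x::ab_group_add) \<Rightarrow> 'x) \<Rightarrow> bool" where
  "complex_vs s \<longleftrightarrow>
     (\<forall>c x y. s c (x + y) = s c x + s c y) \<and>
     (\<forall>c d x. s (c + d) x = s c x + s d x) \<and>
     (\<forall>c d x. s c (s d x) = s (c * d) x) \<and>
     (\<forall>x. s 1 x = x)"

definition star_algebra :: "('a::ring) pro_alg \<Rightarrow> bool" where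
  "star_algebra A \<longleftrightarrow>
     complex_vs (sm A) \<and>
     (\<forall>c x y. sm A c (x * y) = sm A c x * y) \<and>
     (\<forall>c x y. sm A c (x * y) = x * sm A c y) \<and>
     (\<forall>x y. st A (x + y) = st A x + st A y) \<and>
     (\<forall>c x. st A (sm A c x) = sm A (cnj c) (st A x)) \<and>
     (\<forall>x y. st A (x * y) = st A y * st A x) \<and>
     (\<forall>x. st A (st A x) = x)"

definition cstar_seminorm :: "('a::ring) pro_alg \<Rightarrow> ('a \<Rightarrow> real) \<Rightarrow> bool" where
  "cstar_seminorm A p \<longleftrightarrow>
     (\<forall>x. 0 \<le> p x) \<and>
     (\<forall>x y. p (x + y) \<le> p x + p y) \<and>
     (\<forall>c x. p (sm A c x) = cmod c * p x) \<and>
     (\<forall>x y. p (x * y) \<le> p x * p y) \<and>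
     (\<forall>x. p (st A x * x) = (p x)^2)"

text \<open>A seminorm q is continuous for the locally convex topology generated by
  the family N iff it is dominated by a multiple of finitely many members of N.\<close>
definition continuous_wrt :: "('a \<Rightarrow> real) set \<Rightarrow> ('a \<Rightarrow> real) \<Rightarrow> bool" where
  "continuous_wrt N q \<longleftrightarrow>
     (\<exists>F c. finite F \<and> F \<subseteq> N \<and> 0 < c \<and> (\<forall>x. q x \<le> c * (\<Sum>p\<in>F. p x)))"

text \<open>Completeness of the uniform structure given by a family of seminorms,
  via Cauchy filters (equivalent to Cauchy nets).\<close>
definition cauchy_wrt :: "(('x::ab_group_add) \<Rightarrow> real) set \<Rightarrow> 'x filter \<Rightarrow> bool" where
  "cauchy_wrt N F \<longleftrightarrow>
     (\<forall>n\<in>N. \<forall>e>0. eventually (\<lambda>(x, y). n (x - y) < e) (prod_filter F F))"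

definition conv_wrt :: "(('x::ab_group_add) \<Rightarrow> real) set \<Rightarrow> 'x filter \<Rightarrow> 'x \<Rightarrow> bool" where
  "conv_wrt N F l \<longleftrightarrow> (\<forall>n\<in>N. \<forall>e>0. eventually (\<lambda>x. n (x - l) < e) F)"

definition complete_wrt :: "(('x::ab_group_add) \<Rightarrow> real) set \<Rightarrow> bool" where
  "complete_wrt N \<longleftrightarrow>
     (\<forall>F. F \<noteq> bot \<and> cauchy_wrt N F \<longrightarrow> (\<exists>l. conv_wrt N F l))"

definition pro_cstar_algebra :: "('a::ring) pro_alg \<Rightarrow> bool" where
  "pro_cstar_algebra A \<longleftrightarrow>
     star_algebra A \<and>
     sn A = {q. cstar_seminorm A q \<and> continuous_wrt (sn A) q} \<and>
     (\<forall>x. x \<noteq> 0 \<longrightarrow> (\<exists>p\<in>sn A. p x \<noteq> 0)) \<and>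
     complete_wrt (sn A)"

definition positive :: "('a::ring) pro_alg \<Rightarrow> 'a \<Rightarrow> bool" where
  "positive A a \<longleftrightarrow> (\<exists>b. a = st A b * b)"

record ('a, 'x) hmod =
  smx :: "complex \<Rightarrow> 'x \<Rightarrow> 'x"
  act :: "'a \<Rightarrow> 'x \<Rightarrow> 'x"
  ip  :: "'x \<Rightarrow> 'x \<Rightarrow> 'a"

definition pbar :: "('a, 'x) hmod \<Rightarrow> ('a \<Rightarrow> real) \<Rightarrow> 'x \<Rightarrow> real" where
  "pbar X p \<xi> = sqrt (p (ip X \<xi> \<xi>))"

definition hilbert_module ::
  "('a::ring) pro_alg \<Rightarrow> ('a, 'x::ab_group_add) hmod \<Rightarrow> bool" where
  "hilbert_module A X \<longleftrightarrow>
     complex_vs (smx X) \<and>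
     (\<forall>a \<xi> \<eta>. act X a (\<xi> + \<eta>) = act X a \<xi> + act X a \<eta>) \<and>
     (\<forall>a b \<xi>. act X (a + b) \<xi> = act X a \<xi> + act X b \<xi>) \<and>
     (\<forall>a b \<xi>. act X (a * b) \<xi> = act X a (act X b \<xi>)) \<and>
     (\<forall>c a \<xi>. smx X c (act X a \<xi>) = act X (sm A c a) \<xi>) \<and>
     (\<forall>c a \<xi>. smx X c (act X a \<xi>) = act X a (smx X c \<xi>)) \<and>
     (\<forall>\<xi> \<eta> \<zeta>. ip X (\<xi> + \<eta>) \<zeta> = ip X \<xi> \<zeta> + ip X \<eta> \<zeta>) \<and>
     (\<forall>c \<xi> \<eta>. ip X (smx X c \<xi>) \<eta> = sm A c (ip X \<xi> \<eta>)) \<and>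
     (\<forall>a \<xi> \<eta>. ip X (act X a \<xi>) \<eta> = a * ip X \<xi> \<eta>) \<and>
     (\<forall>\<xi> \<eta>. st A (ip X \<xi> \<eta>) = ip X \<eta> \<xi>) \<and>
     (\<forall>\<xi>. positive A (ip X \<xi> \<xi>)) \<and>
     (\<forall>\<xi>. ip X \<xi> \<xi> = 0 \<longrightarrow> \<xi> = 0) \<and>
     complete_wrt (pbar X ` sn A)"

definition adj_hom ::
  "('a::ring) pro_alg \<Rightarrow> ('a, 'x::ab_group_add) hmod \<Rightarrow> ('a, 'y::ab_group_add) hmod
    \<Rightarrow> ('x \<Rightarrow> 'y) \<Rightarrow> ('y \<Rightarrow> 'x) \<Rightarrow> bool" where
  "adj_hom A X Y T Ts \<longleftrightarrow>
     (\<forall>\<xi> \<eta>. T (\<xi> + \<eta>) = T \<xi> + T \<eta>) \<and>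
     (\<forall>c \<xi>. T (smx X c \<xi>) = smx Y c (T \<xi>)) \<and>
     (\<forall>a \<xi>. T (act X a \<xi>) = act Y a (T \<xi>)) \<and>
     (\<forall>p\<in>sn A. \<exists>C\<ge>0. \<forall>\<xi>. pbar Y p (T \<xi>) \<le> C * pbar X p \<xi>) \<and>
     (\<forall>\<xi> \<eta>. ip Y (T \<xi>) \<eta> = ip X \<xi> (Ts \<eta>))"

definition op_le :: "('a::ring) pro_alg \<Rightarrow> ('a, 'y::ab_group_add) hmod
    \<Rightarrow> ('y \<Rightarrow> 'y) \<Rightarrow> ('y \<Rightarrow> 'y) \<Rightarrow> bool" where
  "op_le A Y S R \<longleftrightarrow> (\<forall>\<xi>. positive A (ip Y (R \<xi> - S \<xi>) \<xi>))"

end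

theory Submission
  imports Defs
begin

text \<open>
  Both directions concern a = \<langle>T*\<xi>, T*\<xi>\<rangle> and b = \<langle>L*\<xi>, L*\<xi>\<rangle>: (i) says that b - a is of the form w*w,
  and (ii), applied to all multiples of \<xi>, says that p(dx) \<le> p(cx) for all x, where a = d*d and
  b = c*c. Elements of the algebra act on it by left multiplication, and a seminorm p becomes an
  operator bound, so that scalars can be added although the algebra has no unit. To avoid
  having to show that the quotient by the kernel of p is complete, every C*-algebraic argument at a
  single p is carried out up to an arbitrarily small error. An element f is called positive at p if
  \<parallel>t - f\<parallel> \<le> t for some t; Visser's iteration gives approximate square roots of such elements, and
  Kaplansky's argument shows that every c*c is one of them. Monotonicity of p on positive elements
  gives (i) \<Longrightarrow> (ii). Conversely (ii) makes b - a positive at every p, and rescaled approximate square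
  roots form a Cauchy sequence for all seminorms at once, whose limit w satisfies b - a = w*w.
\<close>

section \<open>Positivity relative to a C*-seminorm\<close>

primrec visser_bound :: "nat \<Rightarrow> real" where
  "visser_bound 0 = 0"
| "visser_bound (Suc n) = (1 + (visser_bound n)\<^sup>2) / 2"

lemma visser_bound_range: "0 \<le> visser_bound n \<and> visser_bound n \<le> 1"
proof (induction n)
  case (Suc n)
  then have "(visser_bound n)\<^sup>2 \<le> 1" by (simp add: power_le_one)
  then show ?case by simp
qed simp

text \<open>In terms of the error e = 1 - \<open>visser_bound n\<close> the recursion is e -> e -
  e^2/2, which is increasing on [0, 1], so an upper bound for the error propagates through
  it.\<close>

lemma visser_bound_error: "1 - visser_bound n \<le> 2 / (real n + 2)"
proof (induction n)
  case (Suc n)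
  define e where "e = 1 - visser_bound n"
  define d where "d = 2 / (real n + 2)"
  have "e \<le> d" "0 \<le> e" "d \<le> 1"
    using Suc visser_bound_range[of n] by (auto simp: e_def d_def)
  have "1 - visser_bound (Suc n) = e - e\<^sup>2 / 2"
    by (simp add: e_def power2_eq_square field_simps)
  also have "\<dots> \<le> d - d\<^sup>2 / 2"
  proof -
    have "0 \<le> (d - e) * (2 - d - e)"
      using \<open>e \<le> d\<close> \<open>d \<le> 1\<close> by simp
    then show ?thesis by (simp add: power2_eq_square algebra_simps)
  qed
  \<comment> \<open>This amounts to (n + 1)(n + 3) \<le> (n + 2)^2.\<close>
  also have "\<dots> \<le> 2 / (real (Suc n) + 2)"
  proof -
    have "d - d\<^sup>2 / 2 = 2 * (real n + 1) / (real n + 2)\<^sup>2"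
      by (simp add: d_def power2_eq_square divide_simps)
    also have "\<dots> \<le> 2 / (real n + 3)"
      by (simp add: power2_eq_square divide_simps) (simp add: algebra_simps)
    finally show ?thesis by (simp add: add.commute)
  qed
  finally show ?case .
qed simp

lemma visser_bound_limit:
  assumes "0 < e" shows "\<exists>n. 1 - visser_bound n \<le> e"
proof -
  obtain n where "2 / e \<le> real n" using real_arch_simple by blast
  then have "2 / (real n + 2) \<le> e" using assms by (simp add: field_simps)
  then show ?thesis using visser_bound_error[of n] by (intro exI[of _ n]) linarith
qed

text \<open>The operators as seen by one seminorm. \<open>bd\<close> and \<open>adj\<close> are
  relations, because an element may have no bound and no adjoint. A bound 0 does not force an
  element to vanish, so equations that hold in the limit appear as estimates.
  \<open>bd_cstar\<close> is the C*-identity in terms of bounds.\<close>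

locale cstar_operators =
  fixes sc :: "complex \<Rightarrow> 'e::{ring,monoid_mult}"
    and adj :: "'e \<Rightarrow> 'e \<Rightarrow> bool"
    and bd :: "'e \<Rightarrow> real \<Rightarrow> bool"
  assumes sc_add: "sc (c + d) = sc c + sc d"
    and sc_mult: "sc (c * d) = sc c * sc d"
    and sc_1: "sc 1 = 1"
    and adj_sc: "adj (sc c) (sc (cnj c))"
    and adj_add: "adj f f' \<Longrightarrow> adj g g' \<Longrightarrow> adj (f + g) (f' + g')"
    and adj_mult: "adj f f' \<Longrightarrow> adj g g' \<Longrightarrow> adj (f * g) (g' * f')"
    and adj_sym: "adj f f' \<Longrightarrow> adj f' f"
    and adj_central: "adj f f' \<Longrightarrow> f * sc c = sc c * f"
    and bd_nonneg: "bd f C \<Longrightarrow> 0 \<le> C"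
    and bd_mono: "bd f C \<Longrightarrow> C \<le> D \<Longrightarrow> bd f D"
    and bd_add: "bd f C \<Longrightarrow> bd g D \<Longrightarrow> bd (f + g) (C + D)"
    and bd_mult: "bd f C \<Longrightarrow> bd g D \<Longrightarrow> bd (f * g) (C * D)"
    and bd_sc: "bd (sc c) (cmod c)"
    and bd_closed: "(\<And>e. 0 < e \<Longrightarrow> bd f (C + e)) \<Longrightarrow> bd f C"
    and bd_cstar: "adj f f' \<Longrightarrow> bd (f' * f) (C\<^sup>2) \<Longrightarrow> 0 \<le> C \<Longrightarrow> bd f C"
begin

section \<open>Real scalars, self-adjoint elements and bounds\<close>

definition rs :: "real \<Rightarrow> 'e" where "rs r = sc (complex_of_real r)"

definition sa :: "'e \<Rightarrow> bool" where "sa f \<longleftrightarrow> adj f f"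

text \<open>In a C*-algebra the norm condition places the spectrum in [0, 2t]; this form needs no
  spectral theory and tolerates small errors.\<close>

definition pos :: "'e \<Rightarrow> bool" where "pos f \<longleftrightarrow> sa f \<and> (\<exists>t. bd (rs t - f) t)"

lemma sc_0: "sc 0 = 0"
  using sc_add[of 0 0] by simp

lemma sc_minus: "sc (- c) = - sc c"
  using sc_add[of c "- c"] by (simp add: sc_0 minus_unique)

lemma rs_0 [simp]: "rs 0 = 0" and rs_1 [simp]: "rs 1 = 1"
  by (simp_all add: rs_def sc_0 sc_1)

lemma rs_add: "rs (a + b) = rs a + rs b"
  by (simp add: rs_def sc_add)

lemma rs_minus: "rs (- a) = - rs a"
  by (simp add: rs_def sc_minus)

lemma rs_diff: "rs (a - b) = rs a - rs b"
  using rs_add[of a "- b"] by (simp add: rs_minus)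

lemma rs_mult: "rs (a * b) = rs a * rs b"
  by (simp add: rs_def sc_mult)

lemma rs_commute: "rs a * rs b = rs b * rs a"
  by (metis rs_mult mult.commute)

lemma rs_left_commute: "rs a * (rs b * x) = rs b * (rs a * x)"
  by (metis rs_commute mult.assoc)

lemma rs_central: "adj f f' \<Longrightarrow> f * rs a = rs a * f"
  by (simp add: rs_def adj_central)

lemma sa_rs_central: "sa f \<Longrightarrow> f * rs a = rs a * f"
  by (simp add: sa_def rs_central)

lemma sa_rs_central': "sa f \<Longrightarrow> f * (rs a * x) = rs a * (f * x)"
  by (metis sa_rs_central mult.assoc)

lemma adj_rs: "adj (rs a) (rs a)"
  using adj_sc[of "complex_of_real a"] by (simp add: rs_def)

lemma adj_uminus: "adj f f' \<Longrightarrow> adj (- f) (- f')"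
  using adj_mult[OF adj_rs[of "-1"], of f f'] rs_central[OF adj_sym, of f f' "-1"]
  by (simp add: rs_minus)

lemma adj_diff: "adj f f' \<Longrightarrow> adj g g' \<Longrightarrow> adj (f - g) (f' - g')"
  using adj_add[OF _ adj_uminus, of f f' g g'] by simp

lemma sa_rs [simp]: "sa (rs a)"
  by (simp add: sa_def adj_rs)

lemma sa_1 [simp]: "sa 1" and sa_0 [simp]: "sa 0"
  using sa_rs[of 1] sa_rs[of 0] by simp_all

lemma sa_add [simp]: "sa f \<Longrightarrow> sa g \<Longrightarrow> sa (f + g)"
  by (simp add: sa_def adj_add)

lemma sa_diff [simp]: "sa f \<Longrightarrow> sa g \<Longrightarrow> sa (f - g)"
  by (simp add: sa_def adj_diff)

lemma sa_mult: "sa f \<Longrightarrow> sa g \<Longrightarrow> f * g = g * f \<Longrightarrow> sa (f * g)"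
  unfolding sa_def using adj_mult[of f f g g] by simp

lemma sa_square [simp]: "sa f \<Longrightarrow> sa (f * f)"
  by (simp add: sa_mult)

lemma sa_rs_mult [simp]: "sa f \<Longrightarrow> sa (rs a * f)"
  by (simp add: sa_mult sa_rs_central)

lemma sa_adj_mult: "adj f f' \<Longrightarrow> sa (f' * f)"
  unfolding sa_def using adj_mult[of f' f f f'] adj_sym by blast

lemma bd_rs: "bd (rs a) \<bar>a\<bar>"
  using bd_sc[of "complex_of_real a"] by (simp add: rs_def)

lemma bd_rs_nonneg: "0 \<le> a \<Longrightarrow> bd (rs a) a"
  using bd_rs[of a] by simp

lemma bd_1: "bd 1 1" and bd_0: "bd 0 0"
  using bd_rs[of 1] bd_rs[of 0] by simp_all

lemma bd_uminus: "bd f C \<Longrightarrow> bd (- f) C"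
  using bd_mult[OF bd_rs[of "-1"], of f C] by (simp add: rs_minus)

lemma bd_diff: "bd f C \<Longrightarrow> bd g D \<Longrightarrow> bd (f - g) (C + D)"
  using bd_add[OF _ bd_uminus, of f C g D] by simp

lemma bd_minus_commute: "bd (f - g) C \<Longrightarrow> bd (g - f) C"
  using bd_uminus[of "f - g" C] by simp

lemma bd_rs_mult: "bd f C \<Longrightarrow> bd (rs a * f) (\<bar>a\<bar> * C)"
  by (rule bd_mult[OF bd_rs])

text \<open>The bounds of \<open>f\<close> are nonnegative and, by \<open>bd_closed\<close>, their
  infimum is again a bound. It plays the role of the norm of \<open>f\<close>.\<close>

lemma least_bound:
  assumes "bd f C"
  obtains K where "bd f K" "\<And>D. bd f D \<Longrightarrow> K \<le> D"
proof -
  define S where "S = {K. bd f K}"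
  have ne: "S \<noteq> {}" and bb: "bdd_below S"
    using assms bd_nonneg by (auto simp: S_def bdd_below_def)
  have "bd f (Inf S)"
  proof (rule bd_closed)
    fix e :: real assume "0 < e"
    then obtain k where "k \<in> S" "k < Inf S + e"
      using ne cInf_lessD[of S "Inf S + e"] by auto
    then show "bd f (Inf S + e)" using bd_mono by (auto simp: S_def)
  qed
  moreover have "Inf S \<le> D" if "bd f D" for D
    using bb that by (intro cInf_lower) (simp_all add: S_def)
  ultimately show thesis using that by blast
qed

lemma bd_adj:
  assumes "adj f f'" "bd f C" "bd f' D" shows "bd f' C"
proof -
  \<comment> \<open>If K bounds f', then so does sqrt (C K); hence the least K is at most C.\<close>
  obtain K where K: "bd f' K" "\<And>D. bd f' D \<Longrightarrow> K \<le> D"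
    using least_bound[OF assms(3)] by blast
  have nn: "0 \<le> C" "0 \<le> K" using assms K bd_nonneg by auto
  have "bd (f * f') ((sqrt (C * K))\<^sup>2)"
    using bd_mult[OF assms(2) K(1)] nn by simp
  then have "bd f' (sqrt (C * K))"
    using bd_cstar[OF adj_sym[OF assms(1)]] nn by simp
  then have "K \<le> sqrt (C * K)" by (rule K(2))
  then have "K\<^sup>2 \<le> C * K"
    using nn power_mono[of K "sqrt (C * K)" 2] by simp
  then have "K \<le> C"
    using nn by (cases "K = 0") (auto simp: power2_eq_square)
  then show ?thesis using K bd_mono by blast
qed

lemma bd_sa_square: "sa f \<Longrightarrow> bd (f * f) C \<Longrightarrow> bd f (sqrt C)"
  using bd_cstar[of f f "sqrt C"] bd_nonneg[of "f * f" C] by (simp add: sa_def)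

section \<open>Visser's iteration, whose fixed points T satisfy (1 - T)^2 = 1 - u, and approximate
  square roots\<close>

primrec visser :: "'e \<Rightarrow> nat \<Rightarrow> 'e" where
  "visser u 0 = 0"
| "visser u (Suc n) = rs (1/2) * (u + visser u n * visser u n)"

lemma rs_half_double: "rs (1/2) * x + rs (1/2) * x = x"
  using rs_add[of "1/2" "1/2"] by (simp flip: distrib_right)

lemma visser_commute:
  assumes "sa z" "z * u = u * z"
  shows "z * visser u n = visser u n * z"
proof (induction n)
  case (Suc n)
  then have "z * (visser u n * visser u n) = visser u n * visser u n * z"
    by (metis mult.assoc)
  then show ?case
    using assms by (simp add: sa_rs_central' algebra_simps)
qed simp

lemma sa_visser [simp]: "sa u \<Longrightarrow> sa (visser u n)"
  by (induction n) auto

lemma bd_visser: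
  assumes "bd u 1" shows "bd (visser u n) (visser_bound n)"
proof (induction n)
  case (Suc n)
  show ?case
    using bd_rs_mult[OF bd_add[OF assms bd_mult[OF Suc Suc]], of "1/2"]
    by (simp add: power2_eq_square)
qed (simp add: bd_0)

text \<open>Consecutive iterates commute, so the next increment is half of
  \<open>(a - b) * (a + b)\<close>; the scalar sequence satisfies the same identity with bounds in
  place of elements.\<close>

lemma bd_visser_step:
  assumes "sa u" "bd u 1"
  shows "bd (visser u (Suc n) - visser u n) (visser_bound (Suc n) - visser_bound n)"
proof (induction n)
  case 0
  show ?case using bd_rs_mult[OF assms(2), of "1/2"] by simp
next
  case (Suc n)
  define a b where "a = visser u (Suc n)" and "b = visser u n"
  define s t where "s = visser_bound (Suc n)" and "t = visser_bound n"
  have bdab: "bd a s" "bd b t" "bd (a - b) (s - t)"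
    using bd_visser[OF assms(2), of n] bd_visser[OF assms(2), of "Suc n"] Suc
    by (simp_all only: a_def b_def s_def t_def)
  have "a * b = b * a"
    unfolding a_def b_def using assms by (intro visser_commute visser_commute[symmetric]) auto
  then have "visser u (Suc (Suc n)) - visser u (Suc n) = rs (1/2) * ((a - b) * (a + b))"
    using visser.simps(2)[of u "Suc n"] visser.simps(2)[of u n]
    unfolding a_def[symmetric] b_def[symmetric]
    by (simp add: algebra_simps)
  moreover have "bd (rs (1/2) * ((a - b) * (a + b))) (\<bar>1/2\<bar> * ((s - t) * (s + t)))"
    by (intro bd_rs_mult bd_mult bd_add bdab)
  moreover have "\<bar>1/2\<bar> * ((s - t) * (s + t)) = visser_bound (Suc (Suc n)) - s"
    using visser_bound.simps(2)[of n]
    unfolding visser_bound.simps(2)[of "Suc n"] s_def[symmetric] t_def[symmetric]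
    by (simp add: field_simps power2_eq_square)
  ultimately show ?case unfolding s_def by metis
qed

text \<open>The defect of the equation (1 - T)^2 = 1 - u at an iterate is exactly twice the
  following increment.\<close>

lemma bd_visser_error:
  assumes "sa u" "bd u 1"
  shows "bd ((1 - visser u n) * (1 - visser u n) - (1 - u)) ((1 - visser_bound n)\<^sup>2)"
proof -
  let ?d = "visser u (Suc n) - visser u n"
  have "(1 - visser u n) * (1 - visser u n) - (1 - u) = ?d + ?d"
    using rs_half_double[of "u + visser u n * visser u n"] by (simp add: algebra_simps)
  moreover have "2 * (visser_bound (Suc n) - visser_bound n) = (1 - visser_bound n)\<^sup>2"
    by (simp add: power2_eq_square algebra_simps)
  ultimately show ?thesis
    using bd_add[OF bd_visser_step bd_visser_step, OF assms assms, of n n]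
    by (simp only: mult_2)
qed

text \<open>If t - x has bound t, then u = 1 - x/t is a contraction and x = t (1 - u), so the root
  of x is sqrt t times that of 1 - u.\<close>

definition approx_sqrt :: "real \<Rightarrow> 'e \<Rightarrow> nat \<Rightarrow> 'e" where
  "approx_sqrt t x n = rs (sqrt t) * (1 - visser (1 - rs (1/t) * x) n)"

lemma rs_inverse_cancel: "t \<noteq> 0 \<Longrightarrow> rs t * (rs (1/t) * x) = x"
  using rs_mult[of t "1/t"] by (simp flip: mult.assoc)

lemma approx_sqrt:
  assumes "sa x" "bd (rs t - x) t" "0 < t"
  shows "sa (approx_sqrt t x n)"
    and "bd (rs (sqrt t) - approx_sqrt t x n) (sqrt t)"
    and "bd (approx_sqrt t x n * approx_sqrt t x n - x) (t * (1 - visser_bound n)\<^sup>2)"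
    and "\<And>z. sa z \<Longrightarrow> z * x = x * z \<Longrightarrow> z * approx_sqrt t x n = approx_sqrt t x n * z"
proof -
  define u where "u = 1 - rs (1/t) * x"
  have sau: "sa u" using assms by (simp add: u_def)
  have "rs (1/t) * (rs t - x) = u"
    using assms rs_mult[of "1/t" t] by (simp add: u_def algebra_simps)
  then have bdu: "bd u 1"
    using bd_rs_mult[OF assms(2), of "1/t"] assms by simp
  let ?T = "visser u n"
  have w: "approx_sqrt t x n = rs (sqrt t) * (1 - ?T)"
    by (simp add: approx_sqrt_def u_def)
  show "sa (approx_sqrt t x n)" using sau by (simp add: w)
  have "bd (rs (sqrt t) * ?T) (\<bar>sqrt t\<bar> * 1)"
    using bd_mono[OF bd_visser[OF bdu]] visser_bound_range by (intro bd_rs_mult) blast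
  then show "bd (rs (sqrt t) - approx_sqrt t x n) (sqrt t)"
    using assms by (simp add: w algebra_simps)
  have "rs (sqrt t) * (1 - ?T) * (rs (sqrt t) * (1 - ?T))
      = rs t * ((1 - ?T) * (1 - ?T))"
  proof -
    have "(1 - ?T) * (rs (sqrt t) * (1 - ?T)) = rs (sqrt t) * ((1 - ?T) * (1 - ?T))"
      using sau by (intro sa_rs_central') simp
    moreover have "rs (sqrt t) * rs (sqrt t) = rs t"
      using assms(3) rs_mult[of "sqrt t" "sqrt t"] by simp
    ultimately show ?thesis by (metis mult.assoc)
  qed
  moreover have "x = rs t * (1 - u)"
    using assms rs_inverse_cancel by (simp add: u_def)
  ultimately have "approx_sqrt t x n * approx_sqrt t x n - x
      = rs t * ((1 - ?T) * (1 - ?T) - (1 - u))"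
    unfolding w by (metis right_diff_distrib)
  then show "bd (approx_sqrt t x n * approx_sqrt t x n - x) (t * (1 - visser_bound n)\<^sup>2)"
    using bd_rs_mult[OF bd_visser_error[OF sau bdu], of t n] assms by simp
  show "z * approx_sqrt t x n = approx_sqrt t x n * z" if z: "sa z" "z * x = x * z" for z
  proof -
    have "z * u = u * z" using z by (simp add: u_def algebra_simps sa_rs_central')
    then have "z * ?T = ?T * z" using z by (simp add: visser_commute)
    then show ?thesis using z by (simp add: w algebra_simps sa_rs_central' sa_rs_central)
  qed
qed

section \<open>The cone of positive elements\<close>

lemma pos_sa: "pos x \<Longrightarrow> sa x"
  by (simp add: pos_def)

lemma bd_rs_diff_mono:
  assumes "bd (rs t - x) t" "t \<le> T" shows "bd (rs T - x) T"
proof -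
  have "rs T - x = rs (T - t) + (rs t - x)" by (simp add: rs_diff)
  then show ?thesis
    using bd_add[OF bd_rs_nonneg assms(1), of "T - t"] assms(2) by (simp only:) simp
qed

lemma pos_bounded:
  assumes "pos x" obtains K where "bd x K"
proof -
  obtain t where t: "bd (rs t - x) t" using assms by (auto simp: pos_def)
  have "bd (rs t - (rs t - x)) (t + t)" using t bd_nonneg by (intro bd_diff bd_rs_nonneg) auto
  then show thesis using that by simp
qed

lemma pos_rs: "0 \<le> a \<Longrightarrow> pos (rs a)"
  unfolding pos_def using bd_mono[OF bd_0] by (intro conjI exI[of _ a]) auto

lemma pos_add:
  assumes "pos x" "pos y" shows "pos (x + y)"
proof -
  obtain s t where "bd (rs s - x) s" "bd (rs t - y) t" using assms by (auto simp: pos_def)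
  then have "bd (rs s - x + (rs t - y)) (s + t)" by (rule bd_add)
  then have "bd (rs (s + t) - (x + y)) (s + t)" by (simp add: rs_add algebra_simps)
  then show ?thesis using assms by (auto simp: pos_def)
qed

lemma pos_rs_mult:
  assumes "pos x" "0 \<le> a" shows "pos (rs a * x)"
proof -
  obtain t where "bd (rs t - x) t" using assms by (auto simp: pos_def)
  then have "bd (rs a * (rs t - x)) (a * t)" using bd_rs_mult[of _ t a] assms by simp
  then have "bd (rs (a * t) - rs a * x) (a * t)" by (simp add: rs_mult right_diff_distrib)
  then show ?thesis using assms by (auto simp: pos_def)
qed

lemma pos_rs_diff: "sa x \<Longrightarrow> bd x K \<Longrightarrow> pos (rs K - x)"
  unfolding pos_def by (auto intro!: exI[of _ K])

text \<open>The commutation clause is what later allows approximate roots of commuting elements to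
  be multiplied.\<close>

lemma pos_sqrt:
  assumes "pos x" "0 < e"
  obtains s where "pos s" "bd (s * s - x) e" "\<And>z. sa z \<Longrightarrow> z * x = x * z \<Longrightarrow> z * s = s * z"
proof -
  obtain t where t: "bd (rs t - x) t" using assms by (auto simp: pos_def)
  \<comment> \<open>Rescaling divides by the threshold, and \<open>t\<close> may be 0.\<close>
  define T where "T = t + 1"
  have T: "bd (rs T - x) T" "0 < T"
    using bd_rs_diff_mono[OF t, of T] bd_nonneg[OF t] by (auto simp: T_def)
  obtain n where n: "1 - visser_bound n \<le> sqrt (e / T)"
    using visser_bound_limit[of "sqrt (e / T)"] assms T by auto
  note s = approx_sqrt[OF pos_sa[OF assms(1)] T, where n = n]
  have "(1 - visser_bound n)\<^sup>2 \<le> (sqrt (e / T))\<^sup>2"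
    using n visser_bound_range[of n] by (intro power_mono) auto
  then have "T * (1 - visser_bound n)\<^sup>2 \<le> e"
    using T assms by (simp add: field_simps)
  then have "bd (approx_sqrt T x n * approx_sqrt T x n - x) e"
    using s(3) bd_mono by blast
  moreover have "pos (approx_sqrt T x n)" using s(1,2) by (auto simp: pos_def)
  ultimately show thesis using s(4) that by blast
qed

lemma sc_i_i: "sc \<i> * (sc \<i> * x) = - x"
proof -
  have "sc \<i> * (sc \<i> * x) = sc (\<i> * \<i>) * x" by (simp only: sc_mult mult.assoc)
  then show ?thesis by (simp add: sc_minus sc_1)
qed

text \<open>For u = a + ib and its adjoint v = a - ib, commutation gives vu = uv = a^2 + b^2. The
  C*-identity bounds u and v, and a is their mean.\<close>

lemma bd_sum_squares:
  assumes "sa a" "sa b" "a * b = b * a" "bd (a * a + b * b) K"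
  shows "bd a (sqrt K)"
proof -
  define u where "u = a + sc \<i> * b"
  define v where "v = a - sc \<i> * b"
  have cen: "a * sc c = sc c * a" "b * sc c = sc c * b" for c
    using assms adj_central by (auto simp: sa_def)
  have cen': "a * (sc c * x) = sc c * (a * x)" "b * (sc c * x) = sc c * (b * x)" for c x
    using cen by (metis mult.assoc)+
  have "adj u (a + b * sc (cnj \<i>))"
    unfolding u_def using assms by (intro adj_add adj_mult adj_sc) (auto simp: sa_def)
  then have adj: "adj u v" by (simp add: v_def cen sc_minus)
  have vu: "v * u = a * a + b * b" and uv: "u * v = a * a + b * b"
    using assms(3) by (simp_all add: u_def v_def algebra_simps cen' sc_i_i)
  have K: "0 \<le> K" using assms bd_nonneg by blast
  have "bd u (sqrt K)" "bd v (sqrt K)"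
    using bd_cstar[OF adj, of "sqrt K"] bd_cstar[OF adj_sym[OF adj], of "sqrt K"] K assms(4)
    by (auto simp: vu uv)
  then have "bd (rs (1/2) * (u + v)) (\<bar>1/2\<bar> * (sqrt K + sqrt K))"
    by (intro bd_rs_mult bd_add)
  moreover have "rs (1/2) * (u + v) = a"
    using rs_half_double[of a] by (simp add: u_def v_def algebra_simps)
  ultimately show ?thesis by simp
qed

lemma bd_square: "sa s \<Longrightarrow> bd s (sqrt K) \<Longrightarrow> bd (s * s) K"
  using bd_mult[of s "sqrt K" s "sqrt K"] bd_nonneg[of s "sqrt K"] by simp

text \<open>For self-adjoint h of norm at most one and s = sqrt (1 - h^2), the element h + i s is
  unitary, so its imaginary part s is a contraction.\<close>
lemma bd_rs_diff_square:
  assumes "sa h" "bd (h * h) K" shows "bd (rs K - h * h) K"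
proof (rule bd_closed)
  fix e :: real assume e: "0 < e"
  define y where "y = rs K - h * h"
  obtain s where s: "pos s" "bd (s * s - y) (e/2)" "\<And>z. sa z \<Longrightarrow> z * y = y * z \<Longrightarrow> z * s = s * z"
    using pos_sqrt[OF pos_rs_diff, of "h * h" K "e/2"] assms e by (auto simp: y_def)
  have "h * s = s * h"
    using assms by (intro s) (auto simp: y_def algebra_simps sa_rs_central)
  have K: "0 \<le> K" using assms bd_nonneg by blast
  have "s * s + h * h = rs K + (s * s - y)" by (simp add: y_def)
  then have "bd (s * s + h * h) (K + e/2)"
    using bd_add[OF bd_rs_nonneg[OF K] s(2)] by (simp only:)
  then have "bd (s * s) (K + e/2)"
    using bd_sum_squares[of s h] bd_square \<open>h * s = s * h\<close> pos_sa[OF s(1)] assms(1) by metis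
  then have "bd (s * s - (s * s - y)) (K + e/2 + e/2)" using s(2) by (rule bd_diff)
  then show "bd (rs K - h * h) (K + e)" by (simp add: y_def add.commute)
qed

lemma pos_square:
  assumes "sa h" "bd h C" shows "pos (h * h)"
  using bd_rs_diff_square[OF assms(1) bd_mult[OF assms(2) assms(2)]] assms(1)
  by (auto simp: pos_def)

text \<open>Makes positivity quantitative: every bound of \<open>x\<close> can serve as the
  threshold t in \<open>pos\<close>. The case of squares transfers through an approximate
  root.\<close>

lemma bd_rs_diff:
  assumes "pos x" "bd x K" shows "bd (rs K - x) K"
proof (rule bd_closed)
  fix e :: real assume e: "0 < e"
  obtain s where s: "pos s" "bd (s * s - x) (e/3)"
    using pos_sqrt[OF assms(1), of "e/3"] e by auto
  have "bd (x + (s * s - x)) (K + e/3)" using assms(2) s(2) by (rule bd_add)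
  then have "bd (rs (K + e/3) - s * s) (K + e/3)"
    using bd_rs_diff_square[OF pos_sa[OF s(1)]] by simp
  from bd_diff[OF bd_add[OF this s(2)] bd_rs_nonneg, of "e/3"]
  have "bd (rs (K + e/3) - s * s + (s * s - x) - rs (e/3)) (K + e/3 + e/3 + e/3)"
    using e by simp
  then show "bd (rs K - x) (K + e)" by (simp add: rs_add add.commute)
qed

text \<open>Monotonicity of the norm. The element \<open>K - x\<close> is positive, and commuting
  approximate roots s of x and w of \<open>K - x\<close> have s^2 + w^2 close to K, so
  \<open>bd_sum_squares\<close> applies to s.\<close>

lemma bd_pos_summand:
  assumes "pos x" "pos y" "bd (x + y) K" shows "bd x K"
proof (rule bd_closed)
  fix e :: real assume e: "0 < e"
  define z where "z = rs K - x"
  have K: "0 \<le> K" using assms bd_nonneg by blast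
  have [simp]: "sa x" "sa y" using assms pos_sa by auto
  have "pos (rs K - (x + y) + y)" using assms by (intro pos_add pos_rs_diff) auto
  then have z: "pos z" by (simp add: z_def)
  obtain s where s: "pos s" "bd (s * s - x) (e/3)" "\<And>a. sa a \<Longrightarrow> a * x = x * a \<Longrightarrow> a * s = s * a"
    using pos_sqrt[OF assms(1), of "e/3"] e by auto
  obtain w where w: "pos w" "bd (w * w - z) (e/3)" "\<And>a. sa a \<Longrightarrow> a * z = z * a \<Longrightarrow> a * w = w * a"
    using pos_sqrt[OF z, of "e/3"] e by auto
  have "x * w = w * x" by (intro w) (auto simp: z_def algebra_simps sa_rs_central)
  then have "w * s = s * w" using pos_sa[OF w(1)] by (intro s) auto
  have "bd (rs K + (s * s - x) + (w * w - z)) (K + e/3 + e/3)"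
    using K s w by (intro bd_add bd_rs_nonneg)
  then have "bd (s * s + w * w) (K + e/3 + e/3)" by (simp add: z_def)
  then have "bd (s * s) (K + e/3 + e/3)"
    using bd_sum_squares[of s w] bd_square \<open>w * s = s * w\<close> pos_sa s(1) w(1) by metis
  then have "bd (s * s - (s * s - x)) (K + e/3 + e/3 + e/3)" using s(2) by (rule bd_diff)
  then show "bd x (K + e)" by (simp add: add.commute)
qed

text \<open>A bound of \<open>x\<close>, enlarged by the error, is a threshold for the approximants
  by \<open>bd_rs_diff\<close>, so the thresholds do not escape in the limit.\<close>

lemma pos_closed:
  assumes "sa x" "bd x K" "\<And>e. 0 < e \<Longrightarrow> \<exists>y. pos y \<and> bd (x - y) e"
  shows "pos x"
proof -
  have "bd (rs K - x) K"
  proof (rule bd_closed)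
    fix e :: real assume e: "0 < e"
    obtain y where y: "pos y" "bd (x - y) (e/3)" using assms(3)[of "e/3"] e by auto
    have "bd (x - (x - y)) (K + e/3)" using assms(2) y(2) by (rule bd_diff)
    then have "bd (rs (K + e/3) - y) (K + e/3)" using bd_rs_diff[OF y(1)] by simp
    from bd_diff[OF bd_diff[OF this y(2)] bd_rs_nonneg, of "e/3"]
    have "bd (rs (K + e/3) - y - (x - y) - rs (e/3)) (K + e/3 + e/3 + e/3)"
      using e by simp
    then show "bd (rs K - x) (K + e)" by (simp add: rs_add add.commute)
  qed
  then show ?thesis using assms(1) by (auto simp: pos_def)
qed

text \<open>With commuting approximate roots s and w, the product is close to (s w)^2, the square of
  a self-adjoint element.\<close>

lemma pos_mult:
  assumes "pos x" "pos y" "x * y = y * x" shows "pos (x * y)"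
proof -
  obtain K where K: "bd x K" using pos_bounded[OF assms(1)] .
  obtain L where L: "bd y L" using pos_bounded[OF assms(2)] .
  have nn: "0 \<le> K" "0 \<le> L" using K L bd_nonneg by auto
  have [simp]: "sa x" "sa y" using assms pos_sa by auto
  show ?thesis
  proof (rule pos_closed)
    show "sa (x * y)" using assms by (intro sa_mult) auto
    show "bd (x * y) (K * L)" using K L by (rule bd_mult)
    fix e :: real assume e: "0 < e"
    \<comment> \<open>The total error is K d + d (L + d); the cap at 1 replaces d^2 by d.\<close>
    define d where "d = min 1 (e / (K + L + 1))"
    have d: "0 < d" "d \<le> 1" "d * (K + L + 1) \<le> e"
      using e nn by (auto simp: d_def pos_le_divide_eq[symmetric])
    obtain s where s: "pos s" "bd (s * s - x) d" "\<And>a. sa a \<Longrightarrow> a * x = x * a \<Longrightarrow> a * s = s * a"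
      using pos_sqrt[OF assms(1) d(1)] by auto
    obtain w where w: "pos w" "bd (w * w - y) d" "\<And>a. sa a \<Longrightarrow> a * y = y * a \<Longrightarrow> a * w = w * a"
      using pos_sqrt[OF assms(2) d(1)] by auto
    have "x * w = w * x" using assms by (intro w) auto
    then have ws: "w * s = s * w" using pos_sa[OF w(1)] by (intro s) auto
    have sq: "(s * w) * (s * w) = (s * s) * (w * w)"
      using ws by (metis mult.assoc)
    obtain C where "bd s C" using pos_bounded[OF s(1)] .
    moreover obtain D where "bd w D" using pos_bounded[OF w(1)] .
    ultimately have "bd (s * w) (C * D)" by (rule bd_mult)
    then have "pos ((s * w) * (s * w))"
      using ws pos_sa s(1) w(1) by (intro pos_square sa_mult) auto
    moreover have "bd (x * y - (s * w) * (s * w)) e"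
    proof (rule bd_mono)
      have "bd (w * w) (L + d)" using bd_add[OF L w(2)] by simp
      then have "bd (x * (y - w * w) + (x - s * s) * (w * w)) (K * d + d * (L + d))"
        using K s(2) w(2) bd_minus_commute by (intro bd_add bd_mult) auto
      then show "bd (x * y - (s * w) * (s * w)) (K * d + d * (L + d))"
        unfolding sq by (simp add: algebra_simps)
      have "d * d \<le> d * 1" using d(1,2) by (intro mult_left_mono) auto
      then have "K * d + d * (L + d) \<le> d * (K + L + 1)" by (simp add: algebra_simps)
      then show "K * d + d * (L + d) \<le> e" using d(3) by (rule order_trans)
    qed
    ultimately show "\<exists>p. pos p \<and> bd (x * y - p) e" by blast
  qed
qed

section \<open>Positivity of an adjoint times the element itself\<close>

lemma pos_adj_sum:
  assumes "adj z z'" "bd z C" "bd z' D" shows "pos (z' * z + z * z')"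
proof -
  \<comment> \<open>\<open>R\<close> is twice the real part of z and \<open>J\<close> minus twice
    the imaginary part; R^2 + J^2 is twice the required sum.\<close>
  define R where "R = z + z'"
  define J where "J = sc \<i> * (z - z')"
  have adj': "adj z' z" using assms adj_sym by blast
  have cen: "z * sc c = sc c * z" "z' * sc c = sc c * z'" for c
    using assms(1) adj' adj_central by auto
  have cen': "z * (sc c * x) = sc c * (z * x)" "z' * (sc c * x) = sc c * (z' * x)" for c x
    using cen by (metis mult.assoc)+
  have "adj (sc \<i> * (z - z')) ((z' - z) * sc (cnj \<i>))"
    using assms adj' by (intro adj_mult adj_sc adj_diff)
  then have "sa J" by (simp add: sa_def J_def cen sc_minus algebra_simps)
  moreover have "sa R" using adj_add[OF assms(1) adj'] by (simp add: sa_def R_def add.commute)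
  moreover have "bd J (cmod \<i> * (C + D))" "bd R (C + D)"
    unfolding J_def R_def using assms by (intro bd_mult bd_sc bd_diff bd_add; simp)+
  ultimately have "pos (rs (1/2) * (R * R + J * J))"
    using pos_square by (intro pos_rs_mult pos_add) auto
  also have "R * R + J * J = (z' * z + z * z') + (z' * z + z * z')"
    by (simp add: R_def J_def algebra_simps cen' sc_i_i)
  also have "rs (1/2) * \<dots> = z' * z + z * z'"
    using rs_half_double[of "z' * z + z * z'"] by (simp only: distrib_left)
  finally show ?thesis .
qed

text \<open>Replaces the comparison of the spectra of z'z and zz'. For e = 0 and the least bound t
  of q = z'z, put m = -q. Then zz' is positive, so t - zz' has bound t, and conjugation by z bounds
  t m + m^2 by t^2. Since m \<le> t, this dominates 2 m^2, so m has bound t / sqrt 2 and minimality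
  gives t = 0. The general case carries the errors along.\<close>

lemma bd_adj_mult_of_nearly_neg:
  assumes "adj z z'" "bd z C" "bd z' D" "0 \<le> e" "pos (rs e - z' * z)"
  shows "bd (z' * z) (10 * e)"
proof -
  define q where "q = z' * z"
  define m where "m = rs e - q"
  obtain t where t: "bd q t" and tmin: "\<And>D. bd q D \<Longrightarrow> t \<le> D"
    using least_bound[OF bd_mult[OF assms(3,2)]] unfolding q_def by blast
  have t0: "0 \<le> t" using bd_nonneg[OF t] .
  have saq: "sa q" unfolding q_def using assms(1) by (rule sa_adj_mult)
  have bz: "bd z (sqrt t)" using bd_cstar[OF assms(1), of "sqrt t"] t t0 by (simp add: q_def)
  then have bz': "bd z' (sqrt t)" using bd_adj[OF assms(1) _ assms(3)] by blast
  \<comment> \<open>Adding the nearly negative z'z back to the positive sum z'z + zz' shows that zz'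
    is nearly positive.\<close>
  have "pos (z' * z + z * z' + (rs e - z' * z))"
    using assms by (intro pos_add pos_adj_sum)
  then have "pos (rs e + z * z')" by (simp add: algebra_simps)
  moreover have "bd (rs e + z * z') (e + t)"
    using bd_add[OF bd_rs_nonneg[OF assms(4)] bd_mult[OF bz bz']] t0 by simp
  ultimately have "bd (rs (e + t) - (rs e + z * z')) (e + t)" by (rule bd_rs_diff)
  then have "bd (rs t - z * z') (e + t)" by (simp add: rs_add)
  \<comment> \<open>Conjugation by z turns the estimate for zz' into one for a polynomial in
    \<open>q\<close>.\<close>
  then have "bd (z' * ((rs t - z * z') * z)) (sqrt t * ((e + t) * sqrt t))"
    using bz bz' by (intro bd_mult)
  moreover have "z' * rs t = rs t * z'" using rs_central[OF adj_sym[OF assms(1)]] .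
  then have "z' * ((rs t - z * z') * z) = rs t * q - q * q"
    by (simp add: q_def algebra_simps flip: mult.assoc)
  moreover have "sqrt t * ((e + t) * sqrt t) = t * (e + t)" using t0 by simp
  ultimately have 1: "bd (rs t * q - q * q) (t * (e + t))" by simp
  have sam: "sa m" using saq by (simp add: m_def)
  have bm: "bd m (e + t)" unfolding m_def using t assms(4) by (intro bd_diff bd_rs_nonneg)
  define S where "S = t\<^sup>2 + 5 * t * e + 4 * e\<^sup>2"
  \<comment> \<open>Substituting q = e - m; only the last term on the right is not of order
    e.\<close>
  have "rs (t + e) * m + m * m = rs (t * e - e * e) + rs (3 * e) * m - (rs t * q - q * q)"
  proof -
    have "3 * e = e + e + e" by simp
    then have "rs (3 * e) = rs e + rs e + rs e" by (simp only: rs_add)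
    then show ?thesis
      by (simp add: m_def algebra_simps rs_add rs_diff rs_mult sa_rs_central[OF saq]
        sa_rs_central'[OF saq] rs_commute rs_left_commute)
  qed
  moreover have "bd (rs (t * e - e * e) + rs (3 * e) * m - (rs t * q - q * q))
      (\<bar>t * e - e * e\<bar> + \<bar>3 * e\<bar> * (e + t) + t * (e + t))"
    using 1 bm by (intro bd_diff bd_add bd_rs bd_rs_mult)
  moreover have "\<bar>t * e - e * e\<bar> + \<bar>3 * e\<bar> * (e + t) + t * (e + t) \<le> S"
  proof -
    have "\<bar>t * e - e * e\<bar> \<le> t * e + e * e"
      using t0 assms(4) abs_triangle_ineq4[of "t * e" "e * e"] by simp
    moreover have "\<bar>3 * e\<bar> = 3 * e" using assms(4) by simp
    ultimately show ?thesis by (simp add: S_def power2_eq_square algebra_simps)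
  qed
  ultimately have "bd (rs (t + e) * m + m * m) S" using bd_mono by metis
  \<comment> \<open>Both summands are positive, the second as a product of commuting positive
    elements, so the bound passes to the first.\<close>
  moreover have "rs (t + e) * m + m * m = (m * m + m * m) + (rs (e + t) - m) * m"
    by (simp add: algebra_simps)
  ultimately have "bd ((m * m + m * m) + (rs (e + t) - m) * m) S" by simp
  moreover have "pos (m * m)" using sam bm by (rule pos_square)
  moreover have "pos ((rs (e + t) - m) * m)"
    using assms(5) pos_rs_diff[OF sam bm] sam
    by (intro pos_mult) (auto simp: m_def[symmetric] q_def[symmetric] algebra_simps
        sa_rs_central[OF sam])
  ultimately have "bd (m * m + m * m) S" using bd_pos_summand pos_add by blast
  then have "bd (rs (1/2) * (m * m + m * m)) (S / 2)" using bd_rs_mult[of _ S "1/2"] by simp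
  then have "bd (m * m) (S / 2)" using rs_half_double[of "m * m"] by (simp add: distrib_left)
  then have "bd m (sqrt (S / 2))" using sam bd_sa_square by blast
  then have "bd (rs e - m) (e + sqrt (S / 2))" using assms(4) by (intro bd_diff bd_rs_nonneg)
  then have tS: "t \<le> e + sqrt (S / 2)" by (intro tmin) (simp add: m_def)
  \<comment> \<open>To leading order \<open>tS\<close> reads t \<le> t / sqrt 2 + O(e); squaring
    gives t^2 \<le> 9 t e + 2 e^2, which fails for t > 10 e.\<close>
  have "t \<le> 10 * e"
  proof (rule ccontr)
    assume "\<not> t \<le> 10 * e"
    then have big: "10 * e < t" by simp
    have "(t - e)\<^sup>2 \<le> (sqrt (S / 2))\<^sup>2"
      using tS big assms(4) by (intro power_mono) auto
    also have "\<dots> = S / 2" using t0 assms(4) by (simp add: S_def)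
    finally have "t * t \<le> 9 * (t * e) + 2 * (e * e)"
      by (simp add: S_def power2_eq_square algebra_simps)
    moreover have "10 * e * t < t * t"
      using big assms(4) by (intro mult_strict_right_mono) auto
    moreover have "10 * e * e \<le> t * e" using big assms(4) by (intro mult_right_mono) auto
    moreover have "0 \<le> e * e" by simp
    ultimately show False by (simp add: algebra_simps)
  qed
  then show ?thesis using t bd_mono q_def by blast
qed

text \<open>Kaplansky's argument. With x = c'c and r an approximate absolute value of x, the
  element z = c(r - x) makes z'z nearly negative, hence nearly zero, hence x nearly equals r.\<close>
lemma pos_adj_mult:
  assumes "adj c c'" "bd c C" "bd c' D" shows "pos (c' * c)"
proof (rule pos_closed)
  define x where "x = c' * c"
  define K where "K = D * C"
  have bx: "bd x K" unfolding x_def K_def using assms by (intro bd_mult)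
  then show "bd (c' * c) K" by (simp add: x_def)
  have K0: "0 \<le> K" using bd_nonneg[OF bx] .
  have sax: "sa x" unfolding x_def using assms(1) by (rule sa_adj_mult)
  then show "sa (c' * c)" by (simp add: x_def)
  fix d :: real assume d: "0 < d"
  define V where "V = 2 * K + 1"
  have V: "0 < V" using K0 by (simp add: V_def)
  \<comment> \<open>At the end v^4 has bound 21 V^2 e, and two square roots must bring this down to
    d.\<close>
  define e where "e = min 1 (d^4 / (21 * V * V))"
  have e: "0 < e" "e \<le> 1" "21 * V * V * e \<le> d^4"
  proof -
    show "0 < e" "e \<le> 1" using d V by (auto simp: e_def)
    have "e * (21 * V * V) \<le> d^4"
      using V by (subst pos_le_divide_eq[symmetric]) (auto simp: e_def)
    then show "21 * V * V * e \<le> d^4" by (simp add: mult.commute)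
  qed
  obtain r where r: "pos r" "bd (r * r - x * x) e"
    "\<And>a. sa a \<Longrightarrow> a * (x * x) = (x * x) * a \<Longrightarrow> a * r = r * a"
    using pos_sqrt[OF pos_square[OF sax bx] e(1)] by blast
  have sar: "sa r" using pos_sa[OF r(1)] .
  have xr: "x * r = r * x" using sax by (intro r) (auto simp: mult.assoc)
  have xr': "x * (r * y) = r * (x * y)" for y using xr by (metis mult.assoc)
  have "bd (x * x + (r * r - x * x)) (K * K + e)" using bx r(2) by (intro bd_add bd_mult)
  then have "bd r (sqrt (K * K + e))" using sar by (intro bd_sa_square) auto
  moreover have "sqrt (K * K + e) \<le> K + 1"
    using K0 e by (intro real_le_lsqrt) (auto simp: power2_eq_square algebra_simps)
  ultimately have br: "bd r (K + 1)" using bd_mono by blast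
  define v where "v = r - x"
  have sav: "sa v" using sar sax by (simp add: v_def)
  have "bd v (K + 1 + K)" unfolding v_def using br bx by (rule bd_diff)
  then have bv: "bd v V" by (simp add: V_def add.commute)
  have vr: "v * r = r * v" using xr by (simp add: v_def algebra_simps)
  define f where "f = v * (r * r - x * x)"
  have bf: "bd f (V * e)" unfolding f_def using bv r(2) by (rule bd_mult)
  have saf: "sa f"
    unfolding f_def using sav sar sax
    by (intro sa_mult) (auto simp: v_def algebra_simps xr xr')
  have z: "(v * c') * (c * v) = v * (x * v)" by (simp add: x_def mult.assoc)
  have "pos (r * (v * v) + (rs (V * e) - f))"
  proof (rule pos_add[OF pos_mult[OF r(1) pos_square[OF sav bv]] pos_rs_diff[OF saf bf]])
    show "r * (v * v) = v * v * r" using vr by (metis mult.assoc)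
  qed
  \<comment> \<open>Since v (r + x) v = v (r^2 - x^2) = f, the element -vxv equals r v^2 - f,
    positive up to the small f.\<close>
  moreover have "rs (V * e) - (v * c') * (c * v) = r * (v * v) + (rs (V * e) - f)"
    unfolding z unfolding f_def v_def by (simp add: algebra_simps xr xr')
  ultimately have "pos (rs (V * e) - (v * c') * (c * v))" by (simp only:)
  moreover have "adj (c * v) (v * c')" using assms(1) sav by (intro adj_mult) (auto simp: sa_def)
  ultimately have "bd ((v * c') * (c * v)) (10 * (V * e))"
    using bd_adj_mult_of_nearly_neg[OF _ bd_mult[OF assms(2) bv] bd_mult[OF bv assms(3)]] V e
    by simp
  then have g: "bd (v * (x * v)) (10 * (V * e))" by (simp add: z)
  \<comment> \<open>Subtracting 2 vxv from f = v (r + x) v leaves v (r - x) v = v^3; the bounds add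
    up to 1 + 10 + 10 = 21 times V e.\<close>
  have "bd (f - v * (x * v) - v * (x * v)) (V * e + 10 * (V * e) + 10 * (V * e))"
    using bf g by (intro bd_diff)
  moreover have "f - v * (x * v) - v * (x * v) = v * (v * v)"
    unfolding f_def v_def by (simp add: algebra_simps xr xr')
  ultimately have "bd (v * (v * v)) (21 * (V * e))" by simp
  from bd_mult[OF bv this] have "bd ((v * v) * (v * v)) (V * (21 * (V * e)))"
    by (simp add: mult.assoc)
  then have "bd ((v * v) * (v * v)) (d^4)"
    using e(3) by (elim bd_mono) (simp add: algebra_simps)
  then have "bd v (sqrt (sqrt (d^4)))" using sav by (intro bd_sa_square) auto
  moreover have "sqrt (sqrt (d^4)) = d"
  proof -
    have "d^4 = (d\<^sup>2)\<^sup>2" by simp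
    then show ?thesis using d by (metis real_sqrt_abs abs_of_pos abs_power2)
  qed
  ultimately have "bd (x - r) d" using bd_minus_commute by (simp add: v_def)
  then show "\<exists>y. pos y \<and> bd (c' * c - y) d" using r(1) by (auto simp: x_def)
qed

text \<open>For an approximate root s of \<open>y\<close>, the conjugate is close to the adjoint of
  s c times s c, which \<open>pos_adj_mult\<close> covers.\<close>

lemma pos_conj:
  assumes "pos y" "adj c c'" "bd c C" "bd c' D" shows "pos (c' * (y * c))"
proof -
  obtain K where K: "bd y K" using pos_bounded[OF assms(1)] .
  show ?thesis
  proof (rule pos_closed)
    have say: "sa y" using pos_sa[OF assms(1)] .
    show "bd (c' * (y * c)) (D * (K * C))" using assms K by (intro bd_mult)
    have "adj (c' * (y * c)) ((c' * y) * c)"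
      using assms say by (intro adj_mult adj_sym[OF assms(2)]) (auto simp: sa_def)
    then show "sa (c' * (y * c))" by (simp add: sa_def mult.assoc)
    fix e :: real assume e: "0 < e"
    have nn: "0 \<le> C" "0 \<le> D" using assms bd_nonneg by auto
    define d where "d = e / (D * C + 1)"
    have pp: "0 < D * C + 1" using nn by (simp add: add_nonneg_pos)
    have d: "0 < d" "D * (d * C) \<le> e"
    proof -
      show "0 < d" using e pp by (simp add: d_def)
      then have "d * (D * C) \<le> d * (D * C + 1)" by simp
      also have "\<dots> = e" using pp by (simp add: d_def)
      finally show "D * (d * C) \<le> e" by (simp add: algebra_simps)
    qed
    obtain s where s: "pos s" "bd (s * s - y) d" using pos_sqrt[OF assms(1) d(1)] by blast
    obtain M where M: "bd s M" using pos_bounded[OF s(1)] .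
    have "pos ((c' * s) * (s * c))"
      using pos_sa[OF s(1)] assms M
      by (intro pos_adj_mult[of _ _ "M * C" "D * M"] adj_mult bd_mult) (auto simp: sa_def)
    moreover have "bd (c' * ((y - s * s) * c)) (D * (d * C))"
      using assms s(2) bd_minus_commute by (intro bd_mult) auto
    then have "bd (c' * (y * c) - (c' * s) * (s * c)) e"
      using d(2) bd_mono by (simp add: algebra_simps)
    ultimately show "\<exists>p. pos p \<and> bd (c' * (y * c) - p) e" by blast
  qed
qed

text \<open>By commutation (v^2 - w^2)^2 = (v - w)^4 + 4 (v - w)^2 v w with both terms positive, so
  (v - w)^4 inherits the bound e^2. This later makes approximate roots a Cauchy sequence.\<close>

lemma bd_diff_of_squares:
  assumes "pos v" "pos w" "v * w = w * v" "bd (v * v - w * w) e"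
  shows "bd (v - w) (sqrt e)"
proof -
  have [simp]: "sa v" "sa w" using assms pos_sa by auto
  have wv': "w * (v * x) = v * (w * x)" for x using assms(3) by (metis mult.assoc)
  obtain C where C: "bd v C" using pos_bounded[OF assms(1)] .
  obtain D where D: "bd w D" using pos_bounded[OF assms(2)] .
  define d where "d = v - w"
  have d: "sa d" "bd d (C + D)" unfolding d_def using C D by (auto intro: bd_diff)
  define p where "p = (d * d) * (v * w)"
  have "pos p"
    unfolding p_def
    by (rule pos_mult[OF pos_square[OF d] pos_mult[OF assms(1-3)]])
      (simp add: d_def algebra_simps wv' assms(3)[symmetric])
  then have "pos (p + p + (p + p))" by (intro pos_add)
  moreover have "pos ((d * d) * (d * d))"
    using pos_square[OF sa_square[OF d(1)] bd_mult[OF d(2) d(2)]] .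
  moreover have "(v * v - w * w) * (v * v - w * w) = (d * d) * (d * d) + (p + p + (p + p))"
    by (simp add: p_def d_def algebra_simps wv' assms(3)[symmetric])
  then have "bd ((d * d) * (d * d) + (p + p + (p + p))) (e * e)"
    using bd_mult[OF assms(4) assms(4)] by simp
  ultimately have "bd ((d * d) * (d * d)) (e * e)" using bd_pos_summand by blast
  then have "bd d (sqrt (sqrt (e * e)))" using d(1) by (intro bd_sa_square) auto
  then show ?thesis using bd_nonneg[OF assms(4)] by (simp add: d_def)
qed

section \<open>Approximate inverses and the comparison of c'c with d'd\<close>

lemma pos_power: "pos u \<Longrightarrow> pos (u ^ n)"
proof (induction n)
  case 0
  then show ?case using pos_rs[of 1] by simp
next
  case (Suc n)
  then show ?case using pos_mult[of u "u ^ n"] by (simp add: power_commutes)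
qed

lemma bd_power: "bd u K \<Longrightarrow> bd (u ^ n) (K ^ n)"
  by (induction n) (auto intro: bd_mult bd_1)

text \<open>Partial sums of the Neumann series for the inverse of \<delta> + b.\<close>
lemma approx_inverse:
  assumes "pos b" "bd b M" "0 < M" "0 < \<delta>" "0 < e"
  obtains g where "pos g" "pos (1 - g * (rs \<delta> + b))" "bd (1 - g * (rs \<delta> + b)) e"
    "\<And>z. sa z \<Longrightarrow> z * b = b * z \<Longrightarrow> z * g = g * z"
proof -
  define \<beta> where "\<beta> = rs \<delta> + b"
  define N where "N = M + \<delta>"
  have N: "0 < N" using assms by (simp add: N_def)
  \<comment> \<open>With this choice (\<delta> + b)/N = 1 - u, and u has bound M/N < 1 because of
    the shift \<delta>.\<close>
  define u where "u = rs (1/N) * (rs M - b)"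
  have sab: "sa b" using pos_sa[OF assms(1)] .
  have pu: "pos u" unfolding u_def using N assms sab by (intro pos_rs_mult pos_rs_diff) auto
  have "bd u (\<bar>1/N\<bar> * M)" unfolding u_def using assms by (intro bd_rs_mult bd_rs_diff)
  then have bu: "bd u (M / N)" using N by simp
  have u: "rs (1/N) * \<beta> = 1 - u"
  proof -
    have "rs (1/N) * rs M + rs (1/N) * rs \<delta> = 1"
      using N by (simp flip: rs_mult rs_add add: N_def add_divide_distrib[symmetric])
    then show ?thesis by (simp add: u_def \<beta>_def algebra_simps)
  qed
  have zu: "z * u ^ n = u ^ n * z" if "sa z" "z * b = b * z" for z n
  proof -
    have "z * u = u * z"
      using that sa_rs_central[OF that(1)] sa_rs_central'[OF that(1)]
      by (simp add: u_def algebra_simps)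
    then show ?thesis by (induction n) (simp_all, metis mult.assoc)
  qed
  \<comment> \<open>g is the geometric sum (1/N)(1 + u + ... + u^(n-1)); its residue is exactly a
    power of u, hence positive as well as small.\<close>
  have "\<exists>g. pos g \<and> 1 - g * \<beta> = u ^ n \<and> (\<forall>z. sa z \<longrightarrow> z * b = b * z \<longrightarrow> z * g = g * z)" for n
  proof (induction n)
    case 0
    show ?case using pos_rs[of 0] by (intro exI[of _ 0]) auto
  next
    case (Suc n)
    then obtain g where g: "pos g" "1 - g * \<beta> = u ^ n"
      "\<And>z. sa z \<Longrightarrow> z * b = b * z \<Longrightarrow> z * g = g * z" by blast
    define h where "h = rs (1/N) * u ^ n + g"
    have "pos h" unfolding h_def using N g pu by (intro pos_add pos_rs_mult pos_power) auto
    moreover have "h * \<beta> = u ^ n * (rs (1/N) * \<beta>) + g * \<beta>"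
      using sa_rs_central'[OF pos_sa[OF pos_power[OF pu]]]
      by (simp add: h_def distrib_right mult.assoc)
    then have "1 - h * \<beta> = u ^ Suc n"
      unfolding u using g(2) by (simp add: algebra_simps power_commutes)
    moreover have "z * h = h * z" if "sa z" "z * b = b * z" for z
      using zu[OF that] g(3)[OF that] sa_rs_central'[OF that(1)]
      by (simp add: h_def algebra_simps)
    ultimately show ?case by blast
  qed
  moreover obtain n where n: "(M / N) ^ n < e"
    using real_arch_pow_inv[of e "M / N"] assms N by (auto simp: N_def)
  ultimately obtain g where g: "pos g" "1 - g * \<beta> = u ^ n"
    "\<And>z. sa z \<Longrightarrow> z * b = b * z \<Longrightarrow> z * g = g * z" by blast
  have "pos (1 - g * \<beta>)" "bd (1 - g * \<beta>) e"
    using pos_power[OF pu] bd_mono[OF bd_power[OF bu]] n by (auto simp: g(2))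
  then show thesis using that g unfolding \<beta>_def by blast
qed

text \<open>Conjugating by an approximate inverse square root h of \<delta> + c'c turns the hypothesis
  into h d'd h \<le> 1 up to a small error; conjugating back gives d'd \<le> \<delta> + c'c.\<close>
lemma pos_diff_of_domination:
  assumes c: "adj c c'" "bd c C" "bd c' C'"
    and d: "adj d d'" "bd d D" "bd d' D'"
    and dom: "\<And>h K. bd (c * h) K \<Longrightarrow> bd (d * h) K"
  shows "pos (c' * c - d' * d)"
proof -
  define a where "a = d' * d"
  define b where "b = c' * c"
  have pa: "pos a" unfolding a_def using d by (rule pos_adj_mult)
  have pb: "pos b" unfolding b_def using c by (rule pos_adj_mult)
  note sab = pos_sa[OF pb] and saa = pos_sa[OF pa]
  obtain M0 where "bd b M0" using pos_bounded[OF pb] .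
  then have bM: "bd b (M0 + 1)" "0 < M0 + 1" using bd_mono bd_nonneg[of b M0] by auto
  define M where "M = M0 + 1"
  note M = bM[folded M_def]
  obtain A where A: "bd a A" using pos_bounded[OF pa] .
  have A0: "0 \<le> A" using bd_nonneg[OF A] .
  have "pos (b - a)"
  proof (rule pos_closed)
    show "sa (b - a)" using sab saa by simp
    show "bd (b - a) (M + A)" using M A by (intro bd_diff)
    fix e :: real assume e: "0 < e"
    \<comment> \<open>One half of the error pays for the shift by \<delta>, the other for all terms
      containing \<eta>, which sum to at most \<eta> (3N + 3A).\<close>
    define \<delta> where "\<delta> = e / 2"
    define N where "N = M + \<delta>"
    have dN: "0 < \<delta>" "0 < N" using e M by (auto simp: \<delta>_def N_def)
    define \<eta> where "\<eta> = min 1 (\<delta> / (3 * N + 3 * A))"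
    have \<eta>: "0 < \<eta>" "\<eta> \<le> 1" "\<eta> * (3 * N + 3 * A) \<le> \<delta>"
      using dN A0 by (auto simp: \<eta>_def pos_le_divide_eq[symmetric] add_pos_nonneg)
    define \<beta> where "\<beta> = rs \<delta> + b"
    have sa\<beta>: "sa \<beta>" using sab by (simp add: \<beta>_def)
    have b\<beta>: "bd \<beta> N"
      using bd_add[OF bd_rs_nonneg M(1), of \<delta>] dN by (simp add: \<beta>_def N_def add.commute)
    obtain g where g: "pos g" "pos (1 - g * \<beta>)" "bd (1 - g * \<beta>) (\<eta>/2)"
        "\<And>z. sa z \<Longrightarrow> z * b = b * z \<Longrightarrow> z * g = g * z"
      using approx_inverse[OF pb M dN(1), of "\<eta>/2"] \<eta> unfolding \<beta>_def by auto
    obtain h where h: "pos h" "bd (h * h - g) (\<eta> / (2 * N))"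
        "\<And>z. sa z \<Longrightarrow> z * g = g * z \<Longrightarrow> z * h = h * z"
      using pos_sqrt[OF g(1), of "\<eta> / (2 * N)"] \<eta> dN by auto
    have sah: "sa h" using pos_sa[OF h(1)] .
    have bg: "b * g = g * b" using sab by (intro g(4)) auto
    then have bh: "b * h = h * b" using sab by (intro h(3)) auto
    then have \<beta>h: "\<beta> * h = h * \<beta>"
      using sa_rs_central[OF sah] by (simp add: \<beta>_def algebra_simps)
    have \<beta>h': "h * (\<beta> * x) = \<beta> * (h * x)" for x using \<beta>h by (metis mult.assoc)
    have \<beta>g: "\<beta> * g = g * \<beta>"
      using sa_rs_central[OF pos_sa[OF g(1)]] bg by (simp add: \<beta>_def algebra_simps)
    \<comment> \<open>\<open>g * b\<close> is a positive summand of g \<beta>, and g \<beta> has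
      bound 1 because its distance from 1 is a positive element of bound at most 1.\<close>
    have bgb: "bd (g * b) 1"
    proof (rule bd_pos_summand)
      show "pos (g * b)" using g(1) pb bg by (intro pos_mult) auto
      show "pos (rs \<delta> * g)" using g(1) dN by (intro pos_rs_mult) auto
      have "bd (rs 1 - (1 - g * \<beta>)) 1" using g(2,3) \<eta> by (intro bd_rs_diff) (auto elim: bd_mono)
      then show "bd (g * b + rs \<delta> * g) 1"
        using sa_rs_central[OF pos_sa[OF g(1)], of \<delta>] by (simp add: \<beta>_def algebra_simps)
    qed
    have "bd (g * b + (h * h - g) * b) (1 + \<eta> / (2 * N) * M)"
      using bgb h(2) M(1) by (intro bd_add bd_mult)
    moreover have "\<eta> / (2 * N) * M \<le> \<eta>"
    proof -
      have "\<eta> * M \<le> \<eta> * (2 * N)" using \<eta> M dN by (intro mult_left_mono) (auto simp: N_def)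
      then show ?thesis using dN by (simp add: field_simps)
    qed
    ultimately have "bd (h * h * b) (1 + \<eta>)" by (auto simp: algebra_simps elim: bd_mono)
    moreover have "(h * c') * (c * h) = h * h * b"
      using bh by (simp add: b_def mult.assoc)
    moreover have adjch: "adj (c * h) (h * c')"
      using c sah by (intro adj_mult) (auto simp: sa_def)
    ultimately have "bd (c * h) (sqrt (1 + \<eta>))"
      using bd_cstar[OF adjch, of "sqrt (1 + \<eta>)"] \<eta> by simp
    then have bdh: "bd (d * h) (sqrt (1 + \<eta>))" by (rule dom)
    obtain H where H: "bd h H" using pos_bounded[OF h(1)] .
    have adjdh: "adj (d * h) (h * d')"
      using d sah by (intro adj_mult) (auto simp: sa_def)
    have "bd ((h * d') * (d * h)) (sqrt (1 + \<eta>) * sqrt (1 + \<eta>))"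
      using bd_adj[OF adjdh bdh bd_mult[OF H d(3)]] bdh by (intro bd_mult)
    then have bhah: "bd (h * (a * h)) (1 + \<eta>)" using \<eta> by (simp add: a_def mult.assoc)
    have "sa (h * (a * h))" using sa_adj_mult[OF adjdh] by (simp add: a_def mult.assoc)
    then have P: "pos (rs (1 + \<eta>) - h * (a * h))" using bhah by (rule pos_rs_diff)
    \<comment> \<open>k nearly inverts h: both products are 1 - f with f of bound \<eta>.
      Conjugating by k therefore turns 1 - hah nearly into \<beta> - a.\<close>
    define k where "k = \<beta> * h"
    have sak: "sa k" unfolding k_def using sa\<beta> sah \<beta>h by (rule sa_mult)
    have bk: "bd k (N * H)" unfolding k_def using b\<beta> H by (rule bd_mult)
    define f where "f = 1 - \<beta> * (h * h)"
    have kh: "k * h = 1 - f" "h * k = 1 - f"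
      by (simp_all add: k_def f_def mult.assoc \<beta>h')
    have kk: "k * k = (1 - f) * \<beta>"
      by (simp add: k_def f_def mult.assoc \<beta>h' \<beta>h[symmetric])
    define y where "y = rs (1 + \<eta>) * ((1 - f) * \<beta>) - (1 - f) * (a * (1 - f))"
    have "k * ((rs (1 + \<eta>) - h * (a * h)) * k)
        = rs (1 + \<eta>) * (k * k) - (k * h) * (a * (h * k))"
      using sa_rs_central'[OF sak] by (simp add: algebra_simps)
    then have "k * ((rs (1 + \<eta>) - h * (a * h)) * k) = y"
      by (simp add: y_def kk kh)
    then have "pos y" using pos_conj[OF P _ bk bk] sak by (simp add: sa_def)
    moreover have bf: "bd f \<eta>"
    proof -
      have "bd ((1 - g * \<beta>) - \<beta> * (h * h - g)) (\<eta>/2 + N * (\<eta> / (2 * N)))"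
        using g(3) b\<beta> h(2) by (intro bd_diff[of "1 - g * \<beta>"] bd_mult)
      moreover have "(1 - g * \<beta>) - \<beta> * (h * h - g) = f"
        by (simp add: f_def algebra_simps \<beta>g)
      moreover have "\<eta>/2 + N * (\<eta> / (2 * N)) = \<eta>" using dN by simp
      ultimately show ?thesis by simp
    qed
    moreover have "bd (b - a - y) e"
    proof -
      \<comment> \<open>Apart from the shift \<delta>, every term contains \<eta> or f.\<close>
      have "b - a - y = rs (1 + \<eta>) * (f * \<beta>) - rs \<eta> * \<beta> - f * a - a * f + f * (a * f) - rs \<delta>"
        by (simp add: y_def \<beta>_def rs_add algebra_simps)
      moreover have "bd (rs (1 + \<eta>) * (f * \<beta>) - rs \<eta> * \<beta> - f * a - a * f + f * (a * f) - rs \<delta>)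
          (\<bar>1 + \<eta>\<bar> * (\<eta> * N) + \<bar>\<eta>\<bar> * N + \<eta> * A + A * \<eta> + \<eta> * (A * \<eta>) + \<bar>\<delta>\<bar>)"
        by (intro bd_diff bd_add bd_mult bd_rs bf b\<beta> A)
      moreover have "\<bar>1 + \<eta>\<bar> * (\<eta> * N) + \<bar>\<eta>\<bar> * N + \<eta> * A + A * \<eta> + \<eta> * (A * \<eta>) + \<bar>\<delta>\<bar> \<le> e"
      proof -
        have "\<eta> * (\<eta> * N) \<le> 1 * (\<eta> * N)" "\<eta> * (\<eta> * A) \<le> 1 * (\<eta> * A)"
          using \<eta> dN A0 by (intro mult_right_mono; simp)+
        then have "\<bar>1 + \<eta>\<bar> * (\<eta> * N) + \<bar>\<eta>\<bar> * N + \<eta> * A + A * \<eta> + \<eta> * (A * \<eta>)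
            \<le> \<eta> * (3 * N + 3 * A)"
          using \<eta>(1) by (simp add: algebra_simps)
        then show ?thesis using \<eta>(3) dN by (simp add: \<delta>_def)
      qed
      ultimately show ?thesis using bd_mono by metis
    qed
    ultimately show "\<exists>y. pos y \<and> bd (b - a - y) e" by blast
  qed
  then show ?thesis by (simp add: a_def b_def)
qed

end

section \<open>Left multiplications on a pro-C*-algebra\<close>

typedef (overloaded) 'a aendo = "{f :: 'a::ab_group_add \<Rightarrow> 'a. \<forall>x y. f (x + y) = f x + f y}"
  morphisms app Aendo
  by (rule exI[of _ "\<lambda>x. x"]) simp

setup_lifting type_definition_aendo

lemma app_add: "app f (x + y) = app f x + app f y"
  using app[of f] by simp

lemma app_0: "app f 0 = 0"
  using app_add[of f 0 0] by simp

lemma app_uminus: "app f (- x) = - app f x"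
  using app_add[of f x "- x"] app_0[of f] by (simp add: minus_unique)

instantiation aendo :: (ab_group_add) "{ring, monoid_mult}"
begin

lift_definition zero_aendo :: "'a aendo" is "\<lambda>x. 0" by simp
lift_definition one_aendo :: "'a aendo" is "\<lambda>x. x" by simp
lift_definition plus_aendo :: "'a aendo \<Rightarrow> 'a aendo \<Rightarrow> 'a aendo" is "\<lambda>f g x. f x + g x"
  by (simp add: algebra_simps)
lift_definition minus_aendo :: "'a aendo \<Rightarrow> 'a aendo \<Rightarrow> 'a aendo" is "\<lambda>f g x. f x - g x"
  by (simp add: algebra_simps)
lift_definition uminus_aendo :: "'a aendo \<Rightarrow> 'a aendo" is "\<lambda>f x. - f x"
  by simp
lift_definition times_aendo :: "'a aendo \<Rightarrow> 'a aendo \<Rightarrow> 'a aendo" is "\<lambda>f g x. f (g x)"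
  by simp

instance
  by standard (transfer; simp add: algebra_simps fun_eq_iff)+

end

lemmas app_simps [simp] = zero_aendo.rep_eq one_aendo.rep_eq plus_aendo.rep_eq
  minus_aendo.rep_eq uminus_aendo.rep_eq times_aendo.rep_eq

lift_definition lmul :: "'a::ring \<Rightarrow> 'a aendo" is "\<lambda>a x. a * x"
  by (simp add: distrib_left)

lemmas app_lmul [simp] = lmul.rep_eq

lemma aendo_eqI: "(\<And>x. app f x = app g x) \<Longrightarrow> f = g"
  by (metis app_inject ext)

lemma lmul_add: "lmul (a + b) = lmul a + lmul b"
  and lmul_diff: "lmul (a - b) = lmul a - lmul b"
  and lmul_mult: "lmul (a * b) = lmul a * lmul b"
  by (auto intro!: aendo_eqI simp: algebra_simps)

section \<open>The operators attached to a continuous C*-seminorm\<close>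

locale pro_cstar =
  fixes A :: "('a::ring) pro_alg"
  assumes pro: "pro_cstar_algebra A"
begin

definition scal :: "complex \<Rightarrow> 'a aendo" where "scal c = Aendo (sm A c)"

text \<open>The algebra is viewed as a module over itself with inner product
  \<open>st A x * y\<close>.\<close>

definition adjoint :: "'a aendo \<Rightarrow> 'a aendo \<Rightarrow> bool" where
  "adjoint f g \<longleftrightarrow> (\<forall>x y. st A (app f x) * y = st A x * app g y)"

text \<open>\<open>0 \<le> C\<close> is demanded explicitly because the estimate alone allows
  negative C where p is identically zero.\<close>

definition opbd :: "('a \<Rightarrow> real) \<Rightarrow> 'a aendo \<Rightarrow> real \<Rightarrow> bool" where
  "opbd p f C \<longleftrightarrow> 0 \<le> C \<and> (\<forall>x. p (app f x) \<le> C * p x)"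

lemma star_alg: "star_algebra A" and complete: "complete_wrt (sn A)"
  using pro by (auto simp: pro_cstar_algebra_def)

lemma sn_seminorm: "p \<in> sn A \<Longrightarrow> cstar_seminorm A p"
  using pro unfolding pro_cstar_algebra_def by blast

lemma separated: "(\<And>p. p \<in> sn A \<Longrightarrow> p x = 0) \<Longrightarrow> x = 0"
  using pro unfolding pro_cstar_algebra_def by blast

lemma sm_rules:
  "sm A c (x + y) = sm A c x + sm A c y" "sm A (c + d) x = sm A c x + sm A d x"
  "sm A c (sm A d x) = sm A (c * d) x" "sm A 1 x = x"
  using star_alg by (auto simp: star_algebra_def complex_vs_def)

lemma sm_mult_left: "sm A c x * y = sm A c (x * y)"
  and sm_mult_right: "x * sm A c y = sm A c (x * y)"
  using star_alg unfolding star_algebra_def by metis+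

lemma st_rules [simp]:
  "st A (x + y) = st A x + st A y" "st A (sm A c x) = sm A (cnj c) (st A x)"
  "st A (x * y) = st A y * st A x" "st A (st A x) = x"
  using star_alg by (auto simp: star_algebra_def)

lemma st_0 [simp]: "st A 0 = 0"
  using st_rules(1)[of 0 0] by simp

lemma st_minus [simp]: "st A (- x) = - st A x"
  using st_rules(1)[of x "- x"] by (simp add: minus_unique)

lemma st_diff [simp]: "st A (x - y) = st A x - st A y"
  using st_rules(1)[of x "- y"] by simp

lemma app_scal [simp]: "app (scal c) x = sm A c x"
  unfolding scal_def by (subst Aendo_inverse) (auto simp: sm_rules)

context
  fixes p assumes p: "p \<in> sn A"
begin

lemma p_nonneg: "0 \<le> p x"
  and p_add: "p (x + y) \<le> p x + p y"
  and p_sm: "p (sm A c x) = cmod c * p x"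
  and p_mult: "p (x * y) \<le> p x * p y"
  and p_cstar: "p (st A x * x) = (p x)\<^sup>2"
  using sn_seminorm[OF p] by (auto simp: cstar_seminorm_def)

lemma p_st: "p (st A x) = p x"
proof -
  have le: "p y \<le> p (st A y)" for y
  proof (cases "p y = 0")
    case False
    have "p y * p y \<le> p (st A y) * p y"
      using p_cstar[of y] p_mult[of "st A y" y] by (simp add: power2_eq_square)
    then show ?thesis using False p_nonneg[of y] by simp
  qed (simp add: p_nonneg)
  show ?thesis using le[of x] le[of "st A x"] by simp
qed

end

text \<open>Nondegeneracy of the inner product: tested on x - x', the C*-identity makes every p
  vanish there, and the seminorms separate points.\<close>

lemma st_mult_cancel:
  assumes "\<And>y. st A x * y = st A x' * y" shows "x = x'"
proof -
  have "st A (x - x') * (x - x') = 0" using assms[of "x - x'"] by (simp add: algebra_simps)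
  then have "p (x - x') = 0" if "p \<in> sn A" for p
    using p_cstar[OF that, of "x - x'"] p_sm[OF that, of 0 0] sm_rules(1)[of 0 0 0] by simp
  then show ?thesis using separated[of "x - x'"] by simp
qed

lemma cstar_operators:
  assumes p: "p \<in> sn A"
  shows "cstar_operators scal adjoint (opbd p)"
proof
  show "scal (c + d) = scal c + scal d" "scal (c * d) = scal c * scal d" "scal 1 = 1" for c d
    by (auto intro!: aendo_eqI simp: sm_rules)
  show "adjoint (scal c) (scal (cnj c))" for c
    by (simp add: adjoint_def sm_mult_left sm_mult_right)
  show "adjoint (f + g) (f' + g')" if "adjoint f f'" "adjoint g g'" for f f' g g'
    using that by (simp add: adjoint_def distrib_left distrib_right)
  show "adjoint (f * g) (g' * f')" if "adjoint f f'" "adjoint g g'" for f f' g g'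
    using that by (simp add: adjoint_def)
  show "adjoint f' f" if "adjoint f f'" for f f'
    unfolding adjoint_def
  proof (intro allI)
    fix x y
    have "st A (st A (app f y) * x) = st A (st A y * app f' x)"
      using that by (simp add: adjoint_def)
    then show "st A (app f' x) * y = st A x * app f y" by simp
  qed
  \<comment> \<open>Members of \<open>aendo\<close> are only additive; an adjoint forces complex
    linearity by nondegeneracy.\<close>
  show "f * scal c = scal c * f" if "adjoint f f'" for f f' c
  proof (rule aendo_eqI, simp, rule st_mult_cancel)
    fix x y
    show "st A (app f (sm A c x)) * y = st A (sm A c (app f x)) * y"
      using that by (simp add: adjoint_def sm_mult_left)
  qed
  show "0 \<le> C" if "opbd p f C" for f C using that by (simp add: opbd_def)
  show "opbd p f D" if "opbd p f C" "C \<le> D" for f C D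
    using that p_nonneg[OF p] unfolding opbd_def by (meson order_trans mult_right_mono)
  show "opbd p (f + g) (C + D)" if "opbd p f C" "opbd p g D" for f g C D
    using that unfolding opbd_def
    by (auto simp: distrib_right intro: order_trans[OF p_add[OF p] add_mono])
  show "opbd p (f * g) (C * D)" if "opbd p f C" "opbd p g D" for f g C D
    unfolding opbd_def
  proof (intro conjI allI)
    fix x
    have "p (app f (app g x)) \<le> C * p (app g x)" using that by (simp add: opbd_def)
    also have "\<dots> \<le> C * (D * p x)" using that by (intro mult_left_mono) (auto simp: opbd_def)
    finally show "p (app (f * g) x) \<le> C * D * p x" by (simp add: mult.assoc)
  qed (use that in \<open>simp add: opbd_def\<close>)
  show "opbd p (scal c) (cmod c)" for c
    by (simp add: opbd_def p_sm[OF p])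
  show "opbd p f C" if *: "\<And>e. 0 < e \<Longrightarrow> opbd p f (C + e)" for f C
    unfolding opbd_def
  proof (intro conjI allI)
    have le: "p (app f x) \<le> (C + e) * p x" and nn: "0 \<le> C + e" if "0 < e" for e x
      using *[OF that] unfolding opbd_def by blast+
    show "0 \<le> C" using nn by (rule field_le_epsilon)
    show "p (app f x) \<le> C * p x" for x
    proof (cases "p x = 0")
      case True
      then show ?thesis using le[of 1 x] by simp
    next
      case False
      then have px: "0 < p x" using p_nonneg[OF p, of x] by simp
      show ?thesis
      proof (rule field_le_epsilon)
        fix e :: real assume "0 < e"
        then have "p (app f x) \<le> (C + e / p x) * p x" using px by (intro le) simp
        then show "p (app f x) \<le> C * p x + e" using px by (simp add: distrib_right)
      qed
    qed
  qed
  show "opbd p f C" if adj: "adjoint f f'" and b: "opbd p (f' * f) (C\<^sup>2)" and C: "0 \<le> C" for f f' C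
    unfolding opbd_def
  proof (intro conjI allI C)
    fix x
    \<comment> \<open>The C*-identity at f x, with one factor f moved across the inner
      product.\<close>
    have "(p (app f x))\<^sup>2 = p (st A x * app f' (app f x))"
      using adj by (simp add: adjoint_def flip: p_cstar[OF p])
    also have "\<dots> \<le> p x * p (app f' (app f x))"
      using p_mult[OF p, of "st A x"] by (simp add: p_st[OF p])
    also have "\<dots> \<le> p x * (C\<^sup>2 * p x)"
      using b by (intro mult_left_mono) (simp_all add: opbd_def p_nonneg[OF p])
    also have "\<dots> = (C * p x)\<^sup>2" by (simp add: power2_eq_square)
    finally have "(p (app f x))\<^sup>2 \<le> (C * p x)\<^sup>2" .
    then show "p (app f x) \<le> C * p x"
      by (rule power2_le_imp_le) (rule mult_nonneg_nonneg[OF C p_nonneg[OF p]])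
  qed
qed

lemma adjoint_lmul: "adjoint (lmul a) (lmul (st A a))"
  by (simp add: adjoint_def mult.assoc)

lemma opbd_lmul: "p \<in> sn A \<Longrightarrow> opbd p (lmul a) (p a)"
  by (simp add: opbd_def p_nonneg p_mult)

text \<open>Testing the operator on \<open>st A a\<close> gives p(a)^2 \<le> C p(a). Operator bounds
  thus recover the seminorm.\<close>

lemma opbd_lmulD:
  assumes p: "p \<in> sn A" and "opbd p (lmul a) C" shows "p a \<le> C"
proof -
  have C: "0 \<le> C" using assms by (simp add: opbd_def)
  have "(p a)\<^sup>2 = p (a * st A a)" using p_cstar[OF p, of "st A a"] by (simp add: p_st[OF p])
  also have "\<dots> \<le> C * p a" using assms p_st[OF p, of a] by (metis opbd_def app_lmul)
  finally show ?thesis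
    using C p_nonneg[OF p, of a] by (cases "p a = 0") (auto simp: power2_eq_square)
qed

section \<open>Positivity and square roots inside the algebra\<close>

abbreviation "op_pos p \<equiv> cstar_operators.pos scal adjoint (opbd p)"
abbreviation "real_scal \<equiv> cstar_operators.rs scal"
abbreviation "op_sqrt \<equiv> cstar_operators.approx_sqrt scal"

lemma pos_lmul_square:
  assumes p: "p \<in> sn A" shows "op_pos p (lmul (st A c * c))"
proof -
  interpret cstar_operators scal adjoint "opbd p" using p by (rule cstar_operators)
  show ?thesis
    unfolding lmul_mult using adjoint_lmul opbd_lmul[OF p] opbd_lmul[OF p] by (rule pos_adj_mult)
qed

lemma seminorm_mono:
  assumes p: "p \<in> sn A" and "positive A a" "positive A (b - a)"
  shows "p a \<le> p b"
proof -
  interpret cstar_operators scal adjoint "opbd p" using p by (rule cstar_operators)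
  have "op_pos p (lmul a)" "op_pos p (lmul (b - a))"
    using assms pos_lmul_square[OF p] by (auto simp: positive_def)
  moreover have "opbd p (lmul a + lmul (b - a)) (p b)"
    using opbd_lmul[OF p, of b] by (simp flip: lmul_add)
  ultimately show ?thesis using bd_pos_summand opbd_lmulD[OF p] by blast
qed

lemma pos_diff_of_seminorm_le:
  assumes p: "p \<in> sn A" and le: "\<And>x. p (d * x) \<le> p (c * x)"
  shows "op_pos p (lmul (st A c * c - st A d * d))"
proof -
  interpret cstar_operators scal adjoint "opbd p" using p by (rule cstar_operators)
  show ?thesis
    unfolding lmul_mult lmul_diff
  proof (rule pos_diff_of_domination)
    \<comment> \<open>The comparison is used at x = \<open>app h y\<close>, so h may be any additive
      map.\<close>
    show "opbd p (lmul d * h) K" if "opbd p (lmul c * h) K" for h K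
      using that le order_trans by (fastforce simp: opbd_def)
  qed (rule adjoint_lmul opbd_lmul[OF p])+
qed

text \<open>The iteration leaves the algebra only by a scalar, and that scalar follows
  \<open>visser_bound\<close>. Splitting it off leaves an element for which completeness of the
  algebra can be used.\<close>

lemma op_sqrt_lmul:
  assumes p: "p \<in> sn A" and x: "st A x = x"
  shows "\<exists>a. st A a = a \<and>
    op_sqrt t (lmul x) n = real_scal (sqrt t * (1 - visser_bound n)) + lmul a"
proof -
  interpret cstar_operators scal adjoint "opbd p" using p by (rule cstar_operators)
  have rs_lmul: "rs r * lmul a = lmul (sm A r a)" for r a
    by (rule aendo_eqI) (simp add: rs_def sm_mult_left)
  have lmul_rs: "lmul a * rs r = rs r * lmul a" for r a
    using adjoint_lmul by (rule rs_central)
  define y where "y = sm A (complex_of_real (1/t)) x"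
  have y: "st A y = y" "rs (1/t) * lmul x = lmul y" by (simp_all add: y_def x rs_lmul)
  have "\<exists>a. st A a = a \<and> visser (1 - lmul y) n = rs (visser_bound n) + lmul a"
  proof (induction n)
    case 0
    show ?case by (intro exI[of _ 0]) (auto intro: aendo_eqI)
  next
    case (Suc n)
    then obtain a where a: "st A a = a" "visser (1 - lmul y) n = rs (visser_bound n) + lmul a"
      by blast
    let ?\<tau> = "visser_bound n"
    \<comment> \<open>The non-scalar part of (1 - y + (\<tau> + a)^2)/2, where \<tau> =
      \<open>visser_bound n\<close>.\<close>
    define b where "b = sm A (complex_of_real (1/2))
      (sm A (complex_of_real ?\<tau>) a + sm A (complex_of_real ?\<tau>) a + a * a - y)"
    have "rs ((1 + ?\<tau>\<^sup>2) / 2) = rs (1/2) * (1 + rs ?\<tau> * rs ?\<tau>)"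
    proof -
      have "(1 + ?\<tau>\<^sup>2) / 2 = 1/2 * (1 + ?\<tau> * ?\<tau>)" by (simp add: power2_eq_square)
      then show ?thesis by (simp only: rs_mult rs_add rs_1)
    qed
    moreover have "lmul b = rs (1/2) * (rs ?\<tau> * lmul a + rs ?\<tau> * lmul a + lmul a * lmul a - lmul y)"
      by (simp only: b_def lmul_add lmul_diff lmul_mult flip: rs_lmul)
    ultimately have "visser (1 - lmul y) (Suc n) = rs ((1 + ?\<tau>\<^sup>2) / 2) + lmul b"
      by (simp add: a(2) lmul_rs algebra_simps)
    moreover have "st A b = b" by (simp add: b_def a y)
    ultimately show ?case by auto
  qed
  then obtain a where a: "st A a = a" "visser (1 - lmul y) n = rs (visser_bound n) + lmul a"
    by blast
  have "approx_sqrt t (lmul x) n = rs (sqrt t) * (1 - (rs (visser_bound n) + lmul a))"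
    by (simp add: approx_sqrt_def y a(2))
  also have "\<dots> = rs (sqrt t * (1 - visser_bound n)) + rs (sqrt t) * lmul (- a)"
    by (simp add: rs_mult rs_diff algebra_simps)
       (auto intro!: aendo_eqI simp: app_uminus)
  finally have "approx_sqrt t (lmul x) n
      = rs (sqrt t * (1 - visser_bound n)) + lmul (sm A (complex_of_real (sqrt t)) (- a))"
    by (simp add: rs_lmul)
  moreover have "st A (sm A (complex_of_real (sqrt t)) (- a)) = sm A (complex_of_real (sqrt t)) (- a)"
    by (simp add: a(1))
  ultimately show ?thesis by blast
qed

text \<open>The approximants are scaled so that, for each seminorm p, all but finitely many of them
  are square roots of x up to a small error; their scalar parts, which do not belong to the
  algebra, tend to zero.\<close>
lemma sqrt_exists:
  assumes x: "st A x = x" and pos: "\<And>p. p \<in> sn A \<Longrightarrow> op_pos p (lmul x)"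
  shows "positive A x"
proof (cases "sn A = {}")
  case True
  then have "x = 0" using separated[of x] by simp
  then show ?thesis by (auto simp: positive_def intro!: exI[of _ 0])
next
  case False
  then obtain p0 where p0: "p0 \<in> sn A" by blast
  \<comment> \<open>The thresholds tend to infinity, so they eventually exceed p x for each
    p.\<close>
  define M where "M n = real (Suc n)" for n
  have M: "1 \<le> M n" for n by (simp add: M_def)
  \<comment> \<open>This accuracy brings both the scalar part \<open>l n\<close> and the error of
    the square below 1/M.\<close>
  have "\<exists>k. 1 - visser_bound k \<le> 1 / (M n)\<^sup>2" for n
    using M[of n] by (intro visser_bound_limit) simp
  then obtain k where k: "\<And>n. 1 - visser_bound (k n) \<le> 1 / (M n)\<^sup>2" by metis
  define W where "W n = op_sqrt (M n) (lmul x) (k n)" for n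
  define l where "l n = sqrt (M n) * (1 - visser_bound (k n))" for n
  \<comment> \<open>The decomposition mentions no seminorm, so the sequence chosen with
    \<open>p0\<close> serves every p.\<close>
  have "\<exists>a. st A a = a \<and> W n = real_scal (l n) + lmul a" for n
    unfolding W_def l_def using op_sqrt_lmul[OF p0 x] .
  then obtain a where a: "\<And>n. st A (a n) = a n" "\<And>n. W n = real_scal (l n) + lmul (a n)"
    by metis
  have l: "0 \<le> l n" "l n \<le> 1 / M n" and err: "M n * (1 - visser_bound (k n))\<^sup>2 \<le> 1 / M n" for n
  proof -
    have v: "0 \<le> 1 - visser_bound (k n)" using visser_bound_range by simp
    then show "0 \<le> l n" using M[of n] by (simp add: l_def)
    have "sqrt (M n) \<le> M n" using M[of n] by (intro real_le_lsqrt) (auto simp: power2_eq_square)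
    then have "l n \<le> M n * (1 / (M n)\<^sup>2)"
      unfolding l_def using v k[of n] M[of n] by (intro mult_mono) auto
    then show "l n \<le> 1 / M n" using M[of n] by (simp add: power2_eq_square)
    have "1 / (M n)\<^sup>2 \<le> 1 / M n"
      using M[of n] by (simp add: power2_eq_square field_simps)
    then have "(1 - visser_bound (k n)) * (1 - visser_bound (k n)) \<le> 1 / M n * (1 / (M n)\<^sup>2)"
      using v k[of n] M[of n] by (intro mult_mono) auto
    then have "M n * (1 - visser_bound (k n))\<^sup>2 \<le> M n * (1 / M n * (1 / (M n)\<^sup>2))"
      using M[of n] by (intro mult_left_mono) (auto simp: power2_eq_square)
    also have "\<dots> \<le> 1 / M n" using \<open>1 / (M n)\<^sup>2 \<le> 1 / M n\<close> M[of n] by simp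
    finally show "M n * (1 - visser_bound (k n))\<^sup>2 \<le> 1 / M n" .
  qed
  have M_lim: "(\<lambda>n. 1 / M n) \<longlonglongrightarrow> 0"
    unfolding M_def using LIMSEQ_inverse_real_of_nat by (simp add: inverse_eq_divide)
  have main: "\<exists>B\<ge>0. \<exists>N. \<forall>n\<ge>N. p (x - a n * a n) \<le> B * (1 / M n) \<and>
      (\<forall>m\<ge>N. p (a n - a m) \<le> sqrt (1 / M n + 1 / M m) + (1 / M n + 1 / M m))"
    if p: "p \<in> sn A" for p
  proof -
    interpret cstar_operators scal adjoint "opbd p" using p by (rule cstar_operators)
    \<comment> \<open>From this index on, \<open>M n\<close> is a valid threshold for x at
      p.\<close>
    obtain N where N: "p x \<le> real N" using real_arch_simple by blast
    have sax: "sa (lmul x)" using adjoint_lmul[of x] by (simp add: sa_def x)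
    have bx: "opbd p (rs (p x) - lmul x) (p x)"
      using bd_rs_diff[OF pos[OF p] opbd_lmul[OF p]] .
    have W: "sa (W n)" "op_pos p (W n)" "opbd p (W n * W n - lmul x) (1 / M n)"
       "\<And>z. sa z \<Longrightarrow> z * lmul x = lmul x * z \<Longrightarrow> z * W n = W n * z" if "n \<ge> N" for n
    proof -
      have "opbd p (rs (M n) - lmul x) (M n)"
        using bd_rs_diff_mono[OF bx] N that by (simp add: M_def)
      note s = approx_sqrt[OF sax this, where n = "k n", folded W_def]
      have Mn: "0 < M n" using M[of n] by simp
      show "sa (W n)" using s(1) Mn .
      show "op_pos p (W n)" using s(1,2) Mn by (auto simp: pos_def)
      show "opbd p (W n * W n - lmul x) (1 / M n)" using bd_mono[OF s(3) err] Mn by simp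
      show "z * W n = W n * z" if "sa z" "z * lmul x = lmul x * z" for z
        using s(4) Mn that by simp
    qed
    have diff: "p (a n - a m) \<le> sqrt (1 / M n + 1 / M m) + (1 / M n + 1 / M m)"
      if nm: "n \<ge> N" "m \<ge> N" for n m
    proof (rule opbd_lmulD[OF p])
      \<comment> \<open>Both approximants commute with everything self-adjoint that commutes with x,
        hence with each other.\<close>
      have "lmul x * W m = W m * lmul x" using W(4)[OF nm(2) sax] by simp
      then have comm: "W n * W m = W m * W n"
        using W(4)[OF nm(1), of "W m"] W(1)[OF nm(2)] by simp
      have "opbd p ((W n * W n - lmul x) - (W m * W m - lmul x)) (1 / M n + 1 / M m)"
        using W(3)[OF nm(1)] W(3)[OF nm(2)] by (rule bd_diff)
      then have "opbd p (W n - W m) (sqrt (1 / M n + 1 / M m))"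
        using bd_diff_of_squares[OF W(2)[OF nm(1)] W(2)[OF nm(2)] comm] by simp
      moreover have "opbd p (rs (l n) - rs (l m)) (1 / M n + 1 / M m)"
        using l by (intro bd_diff bd_mono[OF bd_rs_nonneg])
      ultimately have "opbd p ((W n - W m) - (rs (l n) - rs (l m)))
          (sqrt (1 / M n + 1 / M m) + (1 / M n + 1 / M m))"
        by (rule bd_diff)
      then show "opbd p (lmul (a n - a m)) (sqrt (1 / M n + 1 / M m) + (1 / M n + 1 / M m))"
        by (simp add: a(2) lmul_diff algebra_simps)
    qed
    \<comment> \<open>With a = W - l one has x - a^2 = 2 l W - l^2 - (W^2 - x), where W has bound
      sqrt (p x + 1) and l and W^2 - x have bound 1/M.\<close>
    define B where "B = 2 + 2 * sqrt (p x + 1)"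
    have B: "0 \<le> B" using p_nonneg[OF p, of x] by (simp add: B_def)
    have "p (x - a n * a n) \<le> B * (1 / M n)" if n: "n \<ge> N" for n
    proof (rule opbd_lmulD[OF p])
      have M1: "1 / M n \<le> 1" using M[of n] by simp
      have "opbd p (lmul x + (W n * W n - lmul x)) (p x + 1 / M n)"
        using opbd_lmul[OF p] W(3)[OF n] by (rule bd_add)
      then have "opbd p (W n * W n) (p x + 1)" using M1 by (auto elim: bd_mono)
      then have bW: "opbd p (W n) (sqrt (p x + 1))" using W(1)[OF n] bd_sa_square by blast
      have bl: "opbd p (rs (l n)) (1 / M n)" using l by (intro bd_mono[OF bd_rs_nonneg])
      have "opbd p (rs (l n) * W n + rs (l n) * W n - rs (l n) * rs (l n) - (W n * W n - lmul x))
        (1 / M n * sqrt (p x + 1) + 1 / M n * sqrt (p x + 1) + 1 / M n * (1 / M n) + 1 / M n)"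
        using bW bl W(3)[OF n]
        by (intro bd_diff[of _ _ "W n * W n - lmul x"] bd_add bd_mult
            bd_diff[of _ _ "rs (l n) * rs (l n)"])
      moreover have "rs (l n) * W n + rs (l n) * W n - rs (l n) * rs (l n) - (W n * W n - lmul x)
          = lmul (x - a n * a n)"
        using rs_central[OF adjoint_lmul, of "a n" "l n"]
        by (simp add: a(2) lmul_diff lmul_mult algebra_simps)
      moreover have "1 / M n * (1 / M n) \<le> 1 / M n * 1"
        using M1 M[of n] by (intro mult_left_mono) auto
      then have "1 / M n * sqrt (p x + 1) + 1 / M n * sqrt (p x + 1) + 1 / M n * (1 / M n) + 1 / M n
          \<le> B * (1 / M n)"
        by (simp add: B_def algebra_simps)
      ultimately show "opbd p (lmul (x - a n * a n)) (B * (1 / M n))" using bd_mono by metis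
    qed
    then show ?thesis using diff B by (intro exI[of _ B] conjI exI[of _ N]) auto
  qed
  have "cauchy_wrt (sn A) (filtermap a sequentially)"
    unfolding cauchy_wrt_def
  proof (intro ballI allI impI)
    fix p e assume p: "p \<in> sn A" and e: "(0::real) < e"
    obtain N where N: "\<And>n m. n \<ge> N \<Longrightarrow> m \<ge> N \<Longrightarrow>
        p (a n - a m) \<le> sqrt (1 / M n + 1 / M m) + (1 / M n + 1 / M m)"
      using main[OF p] by blast
    have "((\<lambda>n. sqrt (1 / M n + 1 / M n) + (1 / M n + 1 / M n)) \<longlongrightarrow> sqrt (0 + 0) + (0 + 0)) sequentially"
      by (intro tendsto_intros M_lim)
    then have "eventually (\<lambda>n. sqrt (1 / M n + 1 / M n) + (1 / M n + 1 / M n) < e) sequentially"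
      using e by (intro order_tendstoD) auto
    then obtain N' where N': "sqrt (1 / M N' + 1 / M N') + (1 / M N' + 1 / M N') < e" "N' \<ge> N"
      unfolding eventually_sequentially by (metis nle_le)
    have small: "p (a n - a m) < e" if "n \<ge> N'" "m \<ge> N'" for n m
    proof -
      have "1 / M n \<le> 1 / M N'" "1 / M m \<le> 1 / M N'"
        using that by (auto simp: M_def frac_le)
      then have "sqrt (1 / M n + 1 / M m) + (1 / M n + 1 / M m)
          \<le> sqrt (1 / M N' + 1 / M N') + (1 / M N' + 1 / M N')"
        by (intro add_mono real_sqrt_le_mono) auto
      then show ?thesis using N[of n m] N' that by linarith
    qed
    show "eventually (\<lambda>(u, v). p (u - v) < e)
        (filtermap a sequentially \<times>\<^sub>F filtermap a sequentially)"
      unfolding eventually_prod_filter eventually_filtermap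
    proof (intro exI conjI)
      show "eventually (\<lambda>n. a n \<in> a ` {N'..}) sequentially"
        "eventually (\<lambda>n. a n \<in> a ` {N'..}) sequentially"
        by (auto simp: eventually_sequentially intro!: exI[of _ N'])
      show "\<forall>u v. u \<in> a ` {N'..} \<longrightarrow> v \<in> a ` {N'..} \<longrightarrow> (case (u, v) of (u, v) \<Rightarrow> p (u - v) < e)"
        using small by auto
    qed
  qed
  then obtain w where w: "conv_wrt (sn A) (filtermap a sequentially) w"
    using complete unfolding complete_wrt_def
    by (metis filtermap_bot_iff sequentially_bot)
  have "p (x - st A w * w) = 0" if p: "p \<in> sn A" for p
  proof -
    obtain B N where B: "\<And>n. n \<ge> N \<Longrightarrow> p (x - a n * a n) \<le> B * (1 / M n)"
      using main[OF p] by blast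
    define d where "d n = p (a n - w)" for n
    have d0: "0 \<le> d n" for n using p_nonneg[OF p] by (simp add: d_def)
    have d: "d \<longlonglongrightarrow> 0"
    proof (rule order_tendstoI)
      show "eventually (\<lambda>n. d n < e) sequentially" if "0 < e" for e
        using w p that by (auto simp: conv_wrt_def eventually_filtermap d_def)
      show "eventually (\<lambda>n. e < d n) sequentially" if "e < 0" for e
        using that d0 less_le_trans by (intro always_eventually) blast
    qed
    have bound: "p (x - st A w * w) \<le> B * (1 / M n) + d n * (p w + d n) + p w * d n"
      if n: "n \<ge> N" for n
    proof -
      \<comment> \<open>The a n are self-adjoint, so a n^2 telescopes to \<open>st A w * w\<close>
        without self-adjointness of the limit w.\<close>
      have "x - st A w * w = (x - a n * a n) + st A (a n - w) * a n + st A w * (a n - w)"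
        by (simp add: a(1) algebra_simps)
      then have "p (x - st A w * w) \<le> p (x - a n * a n) + p (st A (a n - w) * a n) + p (st A w * (a n - w))"
        using p_add[OF p, of "x - a n * a n + st A (a n - w) * a n" "st A w * (a n - w)"]
          p_add[OF p, of "x - a n * a n" "st A (a n - w) * a n"] by (simp only:)
      moreover have "p (st A (a n - w) * a n) \<le> d n * p (a n)"
        using p_mult[OF p, of "st A (a n - w)" "a n"] p_st[OF p, of "a n - w"]
        unfolding d_def by simp
      moreover have "d n * p (a n) \<le> d n * (p w + d n)"
        using d0 p_add[OF p, of w "a n - w"] by (intro mult_left_mono) (auto simp: d_def)
      moreover have "p (st A w * (a n - w)) \<le> p w * d n"
        using p_mult[OF p, of "st A w" "a n - w"] p_st[OF p, of w] by (simp add: d_def)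
      ultimately show ?thesis using B[OF n] by linarith
    qed
    have "(\<lambda>n. B * (1 / M n) + d n * (p w + d n) + p w * d n) \<longlonglongrightarrow> B * 0 + 0 * (p w + 0) + p w * 0"
      by (intro tendsto_intros M_lim d)
    then have "p (x - st A w * w) \<le> B * 0 + 0 * (p w + 0) + p w * 0"
      using bound by (intro LIMSEQ_le_const) auto
    then show ?thesis using p_nonneg[OF p, of "x - st A w * w"] by simp
  qed
  then have "x = st A w * w" using separated[of "x - st A w * w"] by simp
  then show ?thesis by (auto simp: positive_def)
qed

end

section \<open>Hilbert modules\<close>

lemma ip_add_left: "hilbert_module A X \<Longrightarrow> ip X (\<xi> + \<eta>) \<zeta> = ip X \<xi> \<zeta> + ip X \<eta> \<zeta>"
  unfolding hilbert_module_def by (elim conjE) simp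

lemma ip_act_left: "hilbert_module A X \<Longrightarrow> ip X (act X a \<xi>) \<eta> = a * ip X \<xi> \<eta>"
  unfolding hilbert_module_def by (elim conjE) simp

lemma st_ip: "hilbert_module A X \<Longrightarrow> st A (ip X \<xi> \<eta>) = ip X \<eta> \<xi>"
  unfolding hilbert_module_def by (elim conjE) (simp only:)

lemma positive_ip: "hilbert_module A X \<Longrightarrow> positive A (ip X \<xi> \<xi>)"
  unfolding hilbert_module_def by (elim conjE) (erule spec)

lemma ip_self_eq_0D: "hilbert_module A X \<Longrightarrow> ip X \<xi> \<xi> = 0 \<Longrightarrow> \<xi> = 0"
  unfolding hilbert_module_def by (elim conjE) metis

lemma ip_diff_left:
  assumes "hilbert_module A X" shows "ip X (\<xi> - \<eta>) \<zeta> = ip X \<xi> \<zeta> - ip X \<eta> \<zeta>"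
  using ip_add_left[OF assms, of "\<xi> - \<eta>" \<eta> \<zeta>] by (metis diff_add_cancel add_diff_cancel_right')

lemma (in pro_cstar) ip_act_right:
  assumes "hilbert_module A X" shows "ip X \<xi> (act X a \<eta>) = ip X \<xi> \<eta> * st A a"
proof -
  have "ip X \<xi> (act X a \<eta>) = st A (a * ip X \<eta> \<xi>)" by (metis ip_act_left[OF assms] st_ip[OF assms])
  then show ?thesis by (simp add: st_ip[OF assms])
qed

lemma ip_ext:
  assumes "hilbert_module A X" "\<And>\<zeta>. ip X \<zeta> \<xi> = ip X \<zeta> \<eta>" shows "\<xi> = \<eta>"
proof -
  have "ip X \<xi> \<zeta> = ip X \<eta> \<zeta>" for \<zeta>
    using assms(2) st_ip[OF assms(1)] by metis
  then have "ip X (\<xi> - \<eta>) (\<xi> - \<eta>) = 0" by (simp add: ip_diff_left[OF assms(1)])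
  then show ?thesis using ip_self_eq_0D[OF assms(1)] by fastforce
qed

text \<open>\<open>adj_hom\<close> states module linearity for T; for \<open>Ts\<close> it follows
  from the adjoint relation by testing against every \<zeta>.\<close>

lemma (in pro_cstar) adjoint_act:
  assumes X: "hilbert_module A X" and Y: "hilbert_module A Y" and T: "adj_hom A X Y T Ts"
  shows "Ts (act Y a \<xi>) = act X a (Ts \<xi>)"
proof (rule ip_ext[OF X])
  fix \<zeta>
  have T: "ip Y (T \<xi>) \<eta> = ip X \<xi> (Ts \<eta>)" for \<xi> \<eta> using T by (simp add: adj_hom_def)
  show "ip X \<zeta> (Ts (act Y a \<xi>)) = ip X \<zeta> (act X a (Ts \<xi>))"
    by (metis T ip_act_right[OF X] ip_act_right[OF Y])
qed

theorem theorem2p8: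
  fixes A :: "('a::ring) pro_alg"
    and X :: "('a, 'x::ab_group_add) hmod"
    and Y :: "('a, 'y::ab_group_add) hmod"
    and T L :: "'x \<Rightarrow> 'y" and Ts Ls :: "'y \<Rightarrow> 'x"
  assumes "pro_cstar_algebra A"
    and "hilbert_module A X" and "hilbert_module A Y"
    and "adj_hom A X Y T Ts" and "adj_hom A X Y L Ls"
  shows "op_le A Y (T \<circ> Ts) (L \<circ> Ls) \<longleftrightarrow>
         (\<forall>\<xi>. \<forall>p\<in>sn A. pbar X p (Ts \<xi>) \<le> pbar X p (Ls \<xi>))"
proof -
  interpret pro_cstar A using assms(1) by unfold_locales
  note X = assms(2) and Y = assms(3)
  have eq: "ip Y ((L \<circ> Ls) \<xi> - (T \<circ> Ts) \<xi>) \<xi> = ip X (Ls \<xi>) (Ls \<xi>) - ip X (Ts \<xi>) (Ts \<xi>)" for \<xi>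
    using assms(4,5) by (simp add: ip_diff_left[OF Y] adj_hom_def)
  show ?thesis
  proof
    assume le: "op_le A Y (T \<circ> Ts) (L \<circ> Ls)"
    show "\<forall>\<xi>. \<forall>p\<in>sn A. pbar X p (Ts \<xi>) \<le> pbar X p (Ls \<xi>)"
    proof (intro allI ballI)
      fix \<xi> p assume p: "p \<in> sn A"
      have "positive A (ip X (Ls \<xi>) (Ls \<xi>) - ip X (Ts \<xi>) (Ts \<xi>))"
        using le unfolding op_le_def eq by blast
      then show "pbar X p (Ts \<xi>) \<le> pbar X p (Ls \<xi>)"
        unfolding pbar_def
        using seminorm_mono[OF p positive_ip[OF X]] by (intro real_sqrt_le_mono)
    qed
  next
    assume le: "\<forall>\<xi>. \<forall>p\<in>sn A. pbar X p (Ts \<xi>) \<le> pbar X p (Ls \<xi>)"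
    show "op_le A Y (T \<circ> Ts) (L \<circ> Ls)"
      unfolding op_le_def eq
    proof
      fix \<xi>
      obtain c d where c: "ip X (Ls \<xi>) (Ls \<xi>) = st A c * c" and d: "ip X (Ts \<xi>) (Ts \<xi>) = st A d * d"
        using positive_ip[OF X] unfolding positive_def by metis
      \<comment> \<open>Acting by the adjoint of x turns the inner square of e into that of e x, so
        multiples of \<xi> test the seminorm inequality at every x.\<close>
      have act: "ip X (act X (st A x) \<eta>) (act X (st A x) \<eta>) = st A (e * x) * (e * x)"
        if "ip X \<eta> \<eta> = st A e * e" for x \<eta> e
        using that by (simp add: ip_act_left[OF X] ip_act_right[OF X] mult.assoc)
      have "p (d * x) \<le> p (c * x)" if p: "p \<in> sn A" for p x
      proof -
        have "pbar X p (Ts (act Y (st A x) \<xi>)) \<le> pbar X p (Ls (act Y (st A x) \<xi>))"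
          using le p by blast
        then have "(p (d * x))\<^sup>2 \<le> (p (c * x))\<^sup>2"
          unfolding adjoint_act[OF X Y assms(4)] adjoint_act[OF X Y assms(5)]
          by (simp only: pbar_def act[OF c] act[OF d] real_sqrt_le_iff p_cstar[OF p])
        then show ?thesis using p_nonneg[OF p] power2_le_imp_le by blast
      qed
      then have "positive A (st A c * c - st A d * d)"
        using pos_diff_of_seminorm_le by (intro sqrt_exists) auto
      then show "positive A (ip X (Ls \<xi>) (Ls \<xi>) - ip X (Ts \<xi>) (Ts \<xi>))" by (simp add: c d)
    qed
  qed
qed

end
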